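(* Let $X$ be a skeletally generated space and let $Y$ be a space co-absolute to $X$. Then $Y$ is skeletally generated.
   Context: All spaces are Tychonoff and all maps are continuous. Two spaces are co-absolute if their absolutes are homeomorphic (the absolute of $X$ is the extremally disconnected Tychonoff space, unique up to homeomorphism, that admits a perfect irreducible map onto $X$). A map $f\colon X\to Y$ is skeletal if the interior in $Y$ of the closure in $Y$ of $f(U)$ is non-empty for every non-empty open $U\subset X$. For two maps $\phi_1,\phi_2$ with domain $X$, write $\phi_1\prec\phi_2$ if there is a map $\phi\colon\phi_1(X)\to\phi_2(X)$ with $\phi_2=\phi\circ\phi_1$. A space $X$ is skeletally generated if there exists an inverse system $S=\{X_\alpha,p^\beta_\alpha,A\}$ of separable metric spaces $X_\alpha$ such that: (1) all bonding maps $p^\beta_\alpha$ are surjective and skeletal; (2) the index set $A$ is $\sigma$-complete (every countable chain in $A$ has a supremum in $A$); (3) for every countable chain $\{\alpha_n:n\ge 1\}\subset A$ with $\beta=\sup\{\alpha_n:n\ge1\}$ the space $X_\beta$ is a (dense) subset of $\varprojlim\{X_{\alpha_n},p^{\alpha_{n+1}}_{\alpha_n}\}$; (4) $X$ is embedded in $\varprojlim S$ such that $p_\alpha(X)=X_\alpha$ for each $\alpha\in A$, where $p_\alpha\colon\varprojlim S\to X_\alpha$ is the $\alpha$-th limit projection; (5) for every bounded continuous real-valued function $f$ on $X$ there exists $\alpha\in A$ such that $p_\alpha\prec f$ (with $p_\alpha$ restricted to $X$). *)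

theory Defs
  imports "HOL-Analysis.Analysis"
begin

definition tychonoff_space :: "'a topology \<Rightarrow> bool" where
  "tychonoff_space X \<longleftrightarrow> completely_regular_space X \<and> Hausdorff_space X"

definition extremally_disconnected_space :: "'a topology \<Rightarrow> bool" where
  "extremally_disconnected_space X \<longleftrightarrow> (\<forall>U. openin X U \<longrightarrow> openin X (X closure_of U))"

text \<open>Continuity and surjectivity are part of \<^const>\<open>perfect_map\<close>.\<close>

definition perfect_irreducible_map :: "'a topology \<Rightarrow> 'b topology \<Rightarrow> ('a \<Rightarrow> 'b) \<Rightarrow> bool" where
  "perfect_irreducible_map X Y f \<longleftrightarrow>
     perfect_map X Y f \<and>
     (\<forall>C. closedin X C \<and> C \<noteq> topspace X \<longrightarrow> f ` C \<noteq> topspace Y)"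

definition absolute_of :: "'e topology \<Rightarrow> 'a topology \<Rightarrow> bool" where
  "absolute_of E X \<longleftrightarrow>
     tychonoff_space E \<and> extremally_disconnected_space E \<and> (\<exists>f. perfect_irreducible_map E X f)"

text \<open>Absolutes are unique up to homeomorphism, so it does not matter which ones are compared.
  HOL cannot quantify over the types of their points, which are therefore passed as arguments;
  the notion is meant to be assumed for arbitrary types.\<close>

definition co_absolute ::
    "'e itself \<Rightarrow> 'f itself \<Rightarrow> 'a topology \<Rightarrow> 'b topology \<Rightarrow> bool" where
  "co_absolute _ _ X Y \<longleftrightarrow>
     (\<exists>(E :: 'e topology) (F :: 'f topology).
        absolute_of E X \<and> absolute_of F Y \<and> E homeomorphic_space F)"

definition skeletal_map :: "'a topology \<Rightarrow> 'b topology \<Rightarrow> ('a \<Rightarrow> 'b) \<Rightarrow> bool" where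
  "skeletal_map X Y f \<longleftrightarrow>
     continuous_map X Y f \<and>
     (\<forall>U. openin X U \<and> U \<noteq> {} \<longrightarrow> Y interior_of (Y closure_of (f ` U)) \<noteq> {})"

text \<open>The relation \<open>f \<prec> g\<close> for maps \<open>f\<close> from \<open>X\<close> to \<open>Y\<close> and \<open>g\<close> from \<open>X\<close> to \<open>Z\<close>.\<close>

definition map_prec ::
    "'a topology \<Rightarrow> 'b topology \<Rightarrow> 'c topology \<Rightarrow> ('a \<Rightarrow> 'b) \<Rightarrow> ('a \<Rightarrow> 'c) \<Rightarrow> bool" where
  "map_prec X Y Z f g \<longleftrightarrow>
     (\<exists>h. continuous_map (subtopology Y (f ` topspace X)) (subtopology Z (g ` topspace X)) h \<and>
          (\<forall>x\<in>topspace X. g x = h (f x)))"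

text \<open>In an index set \<open>A\<close> ordered by \<open>r\<close>, a pair \<open>(\<alpha>, \<beta>) \<in> r\<close> means \<open>\<alpha> \<le> \<beta>\<close>, and
  \<open>p \<alpha> \<beta>\<close> is the bonding map from \<open>S \<beta>\<close> to \<open>S \<alpha>\<close>.\<close>

definition directed_poset :: "'i set \<Rightarrow> 'i rel \<Rightarrow> bool" where
  "directed_poset A r \<longleftrightarrow>
     A \<noteq> {} \<and> partial_order_on A r \<and> (\<forall>\<alpha>\<in>A. \<forall>\<beta>\<in>A. \<exists>\<gamma>\<in>A. (\<alpha>, \<gamma>) \<in> r \<and> (\<beta>, \<gamma>) \<in> r)"

definition is_supremum :: "'i set \<Rightarrow> 'i rel \<Rightarrow> 'i set \<Rightarrow> 'i \<Rightarrow> bool" where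
  "is_supremum A r C \<beta> \<longleftrightarrow>
     \<beta> \<in> A \<and> (\<forall>\<alpha>\<in>C. (\<alpha>, \<beta>) \<in> r) \<and>
     (\<forall>\<gamma>\<in>A. (\<forall>\<alpha>\<in>C. (\<alpha>, \<gamma>) \<in> r) \<longrightarrow> (\<beta>, \<gamma>) \<in> r)"

definition sigma_complete :: "'i set \<Rightarrow> 'i rel \<Rightarrow> bool" where
  "sigma_complete A r \<longleftrightarrow>
     (\<forall>C. C \<subseteq> A \<and> C \<noteq> {} \<and> countable C \<and> C \<in> Chains r \<longrightarrow> (\<exists>\<beta>. is_supremum A r C \<beta>))"

definition inverse_system ::
    "'i set \<Rightarrow> 'i rel \<Rightarrow> ('i \<Rightarrow> 'c topology) \<Rightarrow> ('i \<Rightarrow> 'i \<Rightarrow> 'c \<Rightarrow> 'c) \<Rightarrow> bool" where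
  "inverse_system A r S p \<longleftrightarrow>
     directed_poset A r \<and>
     (\<forall>\<alpha> \<beta>. (\<alpha>, \<beta>) \<in> r \<longrightarrow> continuous_map (S \<beta>) (S \<alpha>) (p \<alpha> \<beta>)) \<and>
     (\<forall>\<alpha>\<in>A. \<forall>x\<in>topspace (S \<alpha>). p \<alpha> \<alpha> x = x) \<and>
     (\<forall>\<alpha> \<beta> \<gamma>. (\<alpha>, \<beta>) \<in> r \<and> (\<beta>, \<gamma>) \<in> r \<longrightarrow>
        (\<forall>x\<in>topspace (S \<gamma>). p \<alpha> \<gamma> x = p \<alpha> \<beta> (p \<beta> \<gamma> x)))"

definition inverse_limit ::
    "'i set \<Rightarrow> 'i rel \<Rightarrow> ('i \<Rightarrow> 'c topology) \<Rightarrow> ('i \<Rightarrow> 'i \<Rightarrow> 'c \<Rightarrow> 'c) \<Rightarrow> ('i \<Rightarrow> 'c) topology" where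
  "inverse_limit A r S p =
     subtopology (product_topology S A) {x. \<forall>\<alpha> \<beta>. (\<alpha>, \<beta>) \<in> r \<longrightarrow> p \<alpha> \<beta> (x \<beta>) = x \<alpha>}"

text \<open>For an increasing sequence \<open>s\<close> with supremum \<open>\<beta>\<close>, ``\<open>S \<beta>\<close> is a dense subset
  of the limit'' refers to the canonical map given by the bonding maps \<open>p (s n) \<beta>\<close>.\<close>

definition sigma_continuous_dense ::
    "'i set \<Rightarrow> 'i rel \<Rightarrow> ('i \<Rightarrow> 'c topology) \<Rightarrow> ('i \<Rightarrow> 'i \<Rightarrow> 'c \<Rightarrow> 'c) \<Rightarrow> bool" where
  "sigma_continuous_dense A r S p \<longleftrightarrow>
     (\<forall>(s :: nat \<Rightarrow> 'i) \<beta>.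
        (\<forall>n. s n \<in> A) \<and> (\<forall>n. (s n, s (Suc n)) \<in> r) \<and> is_supremum A r (range s) \<beta> \<longrightarrow>
        (let L = inverse_limit UNIV {(m, n). m \<le> n} (\<lambda>n. S (s n)) (\<lambda>m n. p (s m) (s n));
             e = (\<lambda>x n. p (s n) \<beta> x)
         in embedding_map (S \<beta>) L e \<and> L closure_of (e ` topspace (S \<beta>)) = topspace L))"

text \<open>Here \<open>e\<close> is the embedding of \<open>X\<close> into the limit, so \<open>\<lambda>x. e x \<alpha>\<close> is the restriction to \<open>X\<close>
  of the \<open>\<alpha>\<close>-th limit projection.\<close>

definition skeletal_generation ::
    "'a topology \<Rightarrow> 'i set \<Rightarrow> 'i rel \<Rightarrow> ('i \<Rightarrow> 'c topology) \<Rightarrow> ('i \<Rightarrow> 'i \<Rightarrow> 'c \<Rightarrow> 'c) \<Rightarrow>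
     ('a \<Rightarrow> 'i \<Rightarrow> 'c) \<Rightarrow> bool" where
  "skeletal_generation X A r S p e \<longleftrightarrow>
     inverse_system A r S p \<and>
     (\<forall>\<alpha>\<in>A. metrizable_space (S \<alpha>) \<and> separable_space (S \<alpha>)) \<and>
     (\<forall>\<alpha> \<beta>. (\<alpha>, \<beta>) \<in> r \<longrightarrow>
        p \<alpha> \<beta> ` topspace (S \<beta>) = topspace (S \<alpha>) \<and> skeletal_map (S \<beta>) (S \<alpha>) (p \<alpha> \<beta>)) \<and>
     sigma_complete A r \<and>
     sigma_continuous_dense A r S p \<and>
     embedding_map X (inverse_limit A r S p) e \<and>
     (\<forall>\<alpha>\<in>A. (\<lambda>x. e x \<alpha>) ` topspace X = topspace (S \<alpha>)) \<and>
     (\<forall>f :: 'a \<Rightarrow> real. continuous_map X euclideanreal f \<and> bounded (f ` topspace X) \<longrightarrow>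
        (\<exists>\<alpha>\<in>A. map_prec X (S \<alpha>) euclideanreal (\<lambda>x. e x \<alpha>) f))"

text \<open>HOL cannot quantify over the type \<open>'i\<close> of indices or the type \<open>'c\<close> of points of the
  members of the system, so these are arguments.  As a hypothesis the notion is meant to be used
  with arbitrary \<open>'i\<close> and \<open>'c\<close>.  As a conclusion about \<open>X :: 'a topology\<close> it is meant to be
  used with \<open>'i = ('a \<Rightarrow> real) set\<close> and \<open>'c = nat \<Rightarrow> real\<close>, which lose nothing: a separable metric
  space is homeomorphic to a subspace of the countable power of the real line, and any system that
  generates \<open>X\<close> can be restricted to a subset of its index set that is directed, closed under
  suprema of countable chains, large enough for all bounded continuous real functions on \<open>X\<close>, and has at most
  as many elements as there are functions from \<open>'a\<close> to the reals.\<close>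

definition skeletally_generated :: "'i itself \<Rightarrow> 'c itself \<Rightarrow> 'a topology \<Rightarrow> bool" where
  "skeletally_generated _ _ X \<longleftrightarrow>
     (\<exists>(A :: 'i set) r (S :: 'i \<Rightarrow> 'c topology) p e. skeletal_generation X A r S p e)"

end

theory Submission
  imports Defs
begin

text \<open>
  Let \<open>f: E \<rightarrow> X\<close> and \<open>g: E \<rightarrow> Y\<close> be irreducible maps from a common absolute. Every non-empty
  open subset of \<open>E\<close> contains the preimage of a non-empty open set of \<open>X\<close>, and of one of \<open>Y\<close>, so
  small open sets can be passed back and forth between \<open>X\<close> and \<open>Y\<close>. Given a system generating \<open>X\<close>,
  assign to each finite set \<open>F\<close> of continuous functions on \<open>Y\<close> an index \<open>\<alpha>(F)\<close>, monotone in \<open>F\<close>, fine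
  enough that each set \<open>{h > 0}\<close> with \<open>h \<in> F\<close> contains (inside \<open>E\<close>) the preimage of an open set of
  \<open>X\<^bsub>\<alpha>(F)\<^esub>\<close>, and a countable set \<open>c(F)\<close> of functions whose sets \<open>{h > 0}\<close> refine (inside \<open>E\<close>) a base of
  \<open>X\<^bsub>\<alpha>(F)\<^esub>\<close>. For a countable set \<open>\<Psi>\<close> closed under \<open>c\<close>, exhausted by finite sets \<open>F\<^sub>n\<close>, let \<open>\<beta>\<close> be
  the supremum of the \<open>\<alpha>(F\<^sub>n)\<close>. The projection \<open>X \<rightarrow> X\<^bsub>\<beta>\<^esub>\<close> is skeletal, and this carries over to the
  diagonal map of \<open>\<Psi>\<close>. Sets closed under \<open>c\<close> are cofinal among countable sets and preserved by unions
  of chains, so the images of \<open>Y\<close> under their diagonal maps form the required system. Skeletality itself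
  is not preserved by unions of chains of sets of functions, which is why \<open>c\<close> is needed.
\<close>

subsection \<open>Embeddings, skeletal maps and irreducible maps\<close>

text \<open>Balls of radius 1/(n+1) around a countable dense set form a base. Countable bases of the
  members \<open>S \<alpha>\<close> are what keeps the sets \<open>c F\<close> countable later
  on.\<close>

lemma separable_metrizable_imp_second_countable:
  assumes "metrizable_space X" "separable_space X"
  shows "second_countable X"
proof -
  obtain M d where "Metric_space M d" and X: "X = Metric_space.mtopology M d"
    using assms(1) unfolding metrizable_space_def by blast
  then interpret Metric_space M d by blast
  obtain C where C: "countable C" "C \<subseteq> M" "mtopology closure_of C = M"
    using assms(2) unfolding separable_space_def X by auto
  define \<B> where "\<B> = (\<lambda>(c, n). mball c (inverse (real (Suc n)))) ` (C \<times> (UNIV :: nat set))"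
  have "\<exists>V\<in>\<B>. x \<in> V \<and> V \<subseteq> U" if U: "openin mtopology U" "x \<in> U" for U x
  proof -
    obtain \<epsilon> where \<epsilon>: "\<epsilon> > 0" "mball x \<epsilon> \<subseteq> U" and "x \<in> M"
      using U by (meson openin_mtopology subsetD)
    obtain n where n: "inverse (real (Suc n)) < \<epsilon> / 2"
      using reals_Archimedean[of "\<epsilon> / 2"] \<epsilon>(1) by auto
    obtain c where c: "c \<in> C" "d x c < inverse (real (Suc n))"
    proof -
      have "x \<in> mtopology closure_of C" using C(3) \<open>x \<in> M\<close> by simp
      moreover have "0 < inverse (real (Suc n))" by simp
      ultimately have "\<exists>c\<in>C. c \<in> mball x (inverse (real (Suc n)))"
        unfolding metric_closure_of by blast
      then show thesis using that by auto
    qed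
    have "mball c (inverse (real (Suc n))) \<subseteq> mball x \<epsilon>"
      using c C(2) \<open>x \<in> M\<close> n by (intro mball_subset) (auto simp: commute)
    moreover have "x \<in> mball c (inverse (real (Suc n)))"
      using c C(2) \<open>x \<in> M\<close> by (auto simp: commute)
    ultimately show ?thesis
      using c(1) \<epsilon>(2) by (intro bexI[of _ "mball c (inverse (real (Suc n)))"]) (auto simp: \<B>_def)
  qed
  moreover have "countable \<B>" "\<forall>V\<in>\<B>. openin mtopology V"
    using C(1) by (auto simp: \<B>_def)
  ultimately show ?thesis
    unfolding second_countable_def X by blast
qed

text \<open>By \<open>base\<close> the topology of \<open>X\<close> is induced by \<open>f\<close>,
  so \<open>f\<close> is open onto its image. Serves both for limits of sequences and for the limit
  of the whole system.\<close>

lemma embedding_map_weak_topologyI: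
  assumes cont: "continuous_map X Y f" and inj: "inj_on f (topspace X)"
    and base: "\<And>U x. openin X U \<Longrightarrow> x \<in> U \<Longrightarrow>
      \<exists>V. openin Y V \<and> f x \<in> V \<and> {x' \<in> topspace X. f x' \<in> V} \<subseteq> U"
  shows "embedding_map X Y f"
proof -
  let ?Z = "subtopology Y (f ` topspace X)"
  have "continuous_map X ?Z f"
    using cont by (auto simp: continuous_map_in_subtopology)
  moreover have "open_map X ?Z f"
    unfolding open_map_def
  proof (intro allI impI)
    fix U assume U: "openin X U"
    have "\<exists>T. openin ?Z T \<and> z \<in> T \<and> T \<subseteq> f ` U" if z: "z \<in> f ` U" for z
    proof -
      obtain x where x: "x \<in> U" "z = f x" using z by blast
      obtain V where V: "openin Y V" "f x \<in> V" "{x' \<in> topspace X. f x' \<in> V} \<subseteq> U"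
        using base[OF U x(1)] by blast
      have "openin ?Z (V \<inter> f ` topspace X)"
        using V(1) openin_subtopology by blast
      moreover have "x \<in> topspace X" using x U openin_subset by blast
      ultimately show ?thesis
        using V x by (intro exI[of _ "V \<inter> f ` topspace X"]) blast
    qed
    then show "openin ?Z (f ` U)"
      by (meson openin_subopen)
  qed
  moreover have "f ` topspace X = topspace ?Z"
    using continuous_map_funspace[OF cont] by (simp add: Int_absorb1 image_subset_iff_funcset)
  ultimately have "homeomorphic_map X ?Z f"
    using inj by (rule bijective_open_imp_homeomorphic_map)
  then show ?thesis unfolding embedding_map_def .
qed

text \<open>An open \<open>V\<close> lies in the closure of a set exactly when every non-empty open
  subset of \<open>V\<close> meets that set. This form can be tested on preimages, without computing
  closures.\<close>

lemma skeletal_map_alt: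
  "skeletal_map X Y f \<longleftrightarrow> continuous_map X Y f \<and>
    (\<forall>U. openin X U \<and> U \<noteq> {} \<longrightarrow> (\<exists>V. openin Y V \<and> V \<noteq> {} \<and>
       (\<forall>W. openin Y W \<and> W \<noteq> {} \<and> W \<subseteq> V \<longrightarrow> f ` U \<inter> W \<noteq> {})))"
proof -
  have "Y interior_of (Y closure_of T) \<noteq> {} \<longleftrightarrow> (\<exists>V. openin Y V \<and> V \<noteq> {} \<and>
       (\<forall>W. openin Y W \<and> W \<noteq> {} \<and> W \<subseteq> V \<longrightarrow> T \<inter> W \<noteq> {}))" (is "?l \<longleftrightarrow> ?r") for T
  proof
    assume ?l
    show ?r
    proof (intro exI conjI allI impI)
      show "openin Y (Y interior_of (Y closure_of T))" by simp
      show "Y interior_of (Y closure_of T) \<noteq> {}" by fact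
      fix W assume W: "openin Y W \<and> W \<noteq> {} \<and> W \<subseteq> Y interior_of (Y closure_of T)"
      then obtain w where "w \<in> W" "w \<in> Y closure_of T"
        using interior_of_subset by fastforce
      then show "T \<inter> W \<noteq> {}" using W by (auto simp: in_closure_of)
    qed
  next
    assume ?r
    then obtain V where V: "openin Y V" "V \<noteq> {}"
      "\<And>W. openin Y W \<Longrightarrow> W \<noteq> {} \<Longrightarrow> W \<subseteq> V \<Longrightarrow> T \<inter> W \<noteq> {}"
      by blast
    have "V \<subseteq> Y closure_of T"
    proof
      fix v assume v: "v \<in> V"
      have "\<exists>y\<in>T. y \<in> O'" if "v \<in> O'" "openin Y O'" for O'
        using V(3)[of "V \<inter> O'"] that v V(1) by blast
      then show "v \<in> Y closure_of T"
        using v V(1) openin_subset by (fastforce simp: in_closure_of)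
    qed
    then show ?l using V interior_of_maximal by blast
  qed
  then show ?thesis unfolding skeletal_map_def by simp
qed

text \<open>For closed surjections this is irreducibility.\<close>

definition tight_map :: "'a topology \<Rightarrow> 'b topology \<Rightarrow> ('a \<Rightarrow> 'b) \<Rightarrow> bool" where
  "tight_map E X f \<longleftrightarrow> continuous_map E X f \<and> f ` topspace E = topspace X \<and>
     (\<forall>W. openin E W \<and> W \<noteq> {} \<longrightarrow>
        (\<exists>U. openin X U \<and> U \<noteq> {} \<and> {x \<in> topspace E. f x \<in> U} \<subseteq> W))"

text \<open>The witness is the complement of the image of \<open>topspace E - W\<close>: open
  because perfect maps are closed, non-empty by irreducibility.\<close>

lemma perfect_irreducible_imp_tight_map:
  assumes "perfect_irreducible_map E X f"
  shows "tight_map E X f"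
proof -
  have pf: "perfect_map E X f"
    and irr: "\<And>C. closedin E C \<Longrightarrow> C \<noteq> topspace E \<Longrightarrow> f ` C \<noteq> topspace X"
    using assms unfolding perfect_irreducible_map_def by blast+
  have "\<exists>U. openin X U \<and> U \<noteq> {} \<and> {x \<in> topspace E. f x \<in> U} \<subseteq> W"
    if W: "openin E W" "W \<noteq> {}" for W
  proof -
    let ?C = "topspace E - W"
    have C: "closedin E ?C" "?C \<noteq> topspace E"
      using W openin_subset by (fastforce simp: closedin_def double_diff)+
    have "closedin X (f ` ?C)"
      using perfect_imp_closed_map[OF pf] C(1) by (simp add: closed_map_def)
    moreover have "topspace X - f ` ?C \<noteq> {}"
      using irr[OF C] pf unfolding perfect_map_def by blast
    ultimately show ?thesis
      by (intro exI[of _ "topspace X - f ` ?C"]) auto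
  qed
  then show ?thesis
    using pf unfolding tight_map_def perfect_map_def by blast
qed

text \<open>Needed to replace two homeomorphic absolutes by a single space \<open>E\<close> mapped
  onto both \<open>X\<close> and \<open>Y\<close>.\<close>

lemma homeomorphic_imp_tight_map:
  assumes "homeomorphic_map E X f"
  shows "tight_map E X f"
proof -
  have "\<exists>U. openin X U \<and> U \<noteq> {} \<and> {x \<in> topspace E. f x \<in> U} \<subseteq> W"
    if W: "openin E W" "W \<noteq> {}" for W
  proof (intro exI[of _ "f ` W"] conjI subsetI)
    show "openin X (f ` W)"
      using homeomorphic_imp_open_map[OF assms] W(1) by (simp add: open_map_def)
    have sub: "W \<subseteq> topspace E" using W(1) by (rule openin_subset)
    fix x assume "x \<in> {x \<in> topspace E. f x \<in> f ` W}"
    then show "x \<in> W"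
      using inj_on_image_mem_iff[OF homeomorphic_imp_injective_map[OF assms] _ sub] by auto
  qed (use W(2) in simp)
  moreover have "continuous_map E X f" "f ` topspace E = topspace X"
    using assms homeomorphic_imp_continuous_map homeomorphic_imp_surjective_map by blast+
  ultimately show ?thesis
    unfolding tight_map_def by blast
qed

lemma tight_map_compose:
  assumes "tight_map E F f" "tight_map F X g"
  shows "tight_map E X (g \<circ> f)"
  unfolding tight_map_def
proof (intro conjI allI impI)
  show "continuous_map E X (g \<circ> f)"
    using assms by (intro continuous_map_compose[of E F f]) (simp_all add: tight_map_def)
  show "(g \<circ> f) ` topspace E = topspace X"
    unfolding image_comp[symmetric] using assms by (simp add: tight_map_def)
  fix W assume "openin E W \<and> W \<noteq> {}"
  then obtain V where V: "openin F V" "V \<noteq> {}" "{x \<in> topspace E. f x \<in> V} \<subseteq> W"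
    using assms(1) unfolding tight_map_def by blast
  then obtain U where "openin X U" "U \<noteq> {}" "{x \<in> topspace F. g x \<in> U} \<subseteq> V"
    using assms(2) unfolding tight_map_def by blast
  moreover have "f ` topspace E = topspace F"
    using assms(1) unfolding tight_map_def by blast
  ultimately show "\<exists>U. openin X U \<and> U \<noteq> {} \<and> {x \<in> topspace E. (g \<circ> f) x \<in> U} \<subseteq> W"
    using V(3) by (intro exI[of _ U]) auto
qed

text \<open>No map between \<open>X\<close> and \<open>Y\<close> is at hand, so open sets are
  compared through their preimages in \<open>E\<close>. The symmetry in \<open>f\<close> and
  \<open>g\<close> allows the passage in both directions.\<close>

lemma tight_map_transfer:
  assumes f: "tight_map E X f" and g: "tight_map E Y g" and U: "openin Y U" "U \<noteq> {}"
  obtains U' where "openin X U'" "U' \<noteq> {}"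
    "{x \<in> topspace E. f x \<in> U'} \<subseteq> {x \<in> topspace E. g x \<in> U}"
proof -
  let ?W = "{x \<in> topspace E. g x \<in> U}"
  have "continuous_map E Y g" "g ` topspace E = topspace Y"
    using g by (simp_all add: tight_map_def)
  then have "openin E ?W"
    using openin_continuous_map_preimage U(1) by blast
  moreover have "U \<subseteq> g ` topspace E"
    using \<open>g ` topspace E = topspace Y\<close> openin_subset[OF U(1)] by simp
  then have "?W \<noteq> {}" using U(2) by blast
  ultimately obtain U' where "openin X U'" "U' \<noteq> {}" "{x \<in> topspace E. f x \<in> U'} \<subseteq> ?W"
    using f[unfolded tight_map_def, THEN conjunct2, THEN conjunct2, THEN spec[of _ ?W]] by blast
  then show thesis by (rule that)
qed

text \<open>\<open>h\<close> is \<open>1 - k\<close> for a function \<open>k\<close> into the unit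
  interval that vanishes at \<open>x\<close> and is 1 off \<open>U\<close>. Boundedness allows
  \<open>h\<close> to be factored through a member of a generating system.\<close>

lemma completely_regular_space_bump:
  assumes "completely_regular_space X" "openin X U" "x \<in> U"
  obtains h :: "'a \<Rightarrow> real" where "continuous_map X euclideanreal h" "bounded (h ` topspace X)"
    "0 < h x" "{y \<in> topspace X. 0 < h y} \<subseteq> U"
proof -
  have "closedin X (topspace X - U) \<and> x \<in> topspace X - (topspace X - U)"
    using assms(2,3) openin_subset by fastforce
  then obtain k :: "'a \<Rightarrow> real" where k: "continuous_map X (top_of_set {0..1}) k"
    "k x = 0" "k ` (topspace X - U) \<subseteq> {1}"
    using assms(1)[unfolded completely_regular_space_def, rule_format] by blast
  have k': "continuous_map X euclideanreal k" "k ` topspace X \<subseteq> {0..1}"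
    using k(1) by (auto simp: continuous_map_in_subtopology)
  have "continuous_map X euclideanreal (\<lambda>y. 1 - k y)"
    using continuous_map_diff[OF continuous_map_canonical_const k'(1)] .
  moreover have "(\<lambda>y. 1 - k y) ` topspace X \<subseteq> {0..1}"
    using k'(2) by auto
  then have "bounded ((\<lambda>y. 1 - k y) ` topspace X)"
    by (rule bounded_subset[OF bounded_closed_interval])
  moreover have "{y \<in> topspace X. 0 < 1 - k y} \<subseteq> U"
    using k(3) by fastforce
  ultimately show thesis
    using k(2) by (intro that[of "\<lambda>y. 1 - k y"]) simp_all
qed

text \<open>A basic box of the product restricts finitely many coordinates, and on threads all of
  them are determined by the one with the largest index.\<close>

lemma inverse_sequence_limit_base:
  fixes T :: "nat \<Rightarrow> 'c topology"
  assumes cont: "\<And>m n. m \<le> n \<Longrightarrow> continuous_map (T n) (T m) (q m n)"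
    and W: "openin (inverse_limit UNIV {(m, n). m \<le> n} T q) W" "w \<in> W"
  obtains n V where "openin (T n) V" "w n \<in> V"
    "{z \<in> topspace (inverse_limit UNIV {(m, n). m \<le> n} T q). z n \<in> V} \<subseteq> W"
proof -
  let ?K = "{x. \<forall>\<alpha> \<beta>. (\<alpha>, \<beta>) \<in> {(m, n). m \<le> n} \<longrightarrow> q \<alpha> \<beta> (x \<beta>) = x \<alpha>}"
  obtain W' where W': "openin (product_topology T UNIV) W'" "W = W' \<inter> ?K"
    using W(1) unfolding inverse_limit_def openin_subtopology by blast
  obtain U where U: "finite {i. U i \<noteq> topspace (T i)}" "\<And>i. openin (T i) (U i)"
    "w \<in> Pi\<^sub>E UNIV U" "Pi\<^sub>E UNIV U \<subseteq> W'"
    using W'(1) W(2) W'(2) unfolding openin_product_topology_alt by (auto 0 3)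
  define J where "J = {i. U i \<noteq> topspace (T i)}"
  \<comment> \<open>The 0 gives \<open>N\<close> a value when no coordinate is restricted; the
    factor \<open>topspace (T N)\<close> of \<open>V\<close> covers the same case.\<close>
  define N where "N = Max (insert 0 J)"
  have N: "i \<le> N" if "i \<in> J" for i
    using that U(1) unfolding N_def J_def by (intro Max_ge) auto
  define V where "V = topspace (T N) \<inter> (\<Inter>i\<in>J. {x \<in> topspace (T N). q i N x \<in> U i})"
  have top: "z i \<in> topspace (T i)" if "z \<in> topspace (inverse_limit UNIV {(m, n). m \<le> n} T q)" for z i
    using that unfolding inverse_limit_def by (auto simp: PiE_iff)
  have qz: "q i N (z N) = z i" if "z \<in> ?K" "i \<in> J" for z i
    using that N[of i] by auto
  show thesis
  proof (rule that[of N V])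
    have "openin (T N) (\<Inter>(insert (topspace (T N)) ((\<lambda>i. {x \<in> topspace (T N). q i N x \<in> U i}) ` J)))"
      using U(1) unfolding J_def[symmetric]
      by (intro openin_Inter) (auto intro!: openin_continuous_map_preimage[OF cont] N U(2))
    then show "openin (T N) V" by (simp add: V_def)
    have "w \<in> topspace (inverse_limit UNIV {(m, n). m \<le> n} T q)"
      using W openin_subset by blast
    then show "w N \<in> V"
      using top[of w] qz[of w] W(2) W'(2) U(3) by (auto simp: V_def PiE_iff)
    show "{z \<in> topspace (inverse_limit UNIV {(m, n). m \<le> n} T q). z N \<in> V} \<subseteq> W"
    proof clarify
      fix z assume z: "z \<in> topspace (inverse_limit UNIV {(m, n). m \<le> n} T q)" "z N \<in> V"
      then have K: "z \<in> ?K" unfolding inverse_limit_def by simp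
      have "z i \<in> U i" for i
      proof (cases "i \<in> J")
        case True
        then show ?thesis using z(2) qz[OF K True] by (auto simp: V_def)
      next
        case False
        then show ?thesis using top[OF z(1)] by (simp add: J_def)
      qed
      then have "z \<in> W'" using U(4) by (auto simp: PiE_iff)
      then show "z \<in> W" using K W'(2) by blast
    qed
  qed
qed

subsection \<open>Generating systems\<close>

text \<open>For continuous \<open>h\<close> this is the cozero set of \<open>max h 0\<close>; on a
  completely regular space these sets form a base.\<close>

definition positive_set :: "'b topology \<Rightarrow> ('b \<Rightarrow> real) \<Rightarrow> 'b set" where
  "positive_set Y h = {y \<in> topspace Y. 0 < h y}"

text \<open>If the positive sets of \<open>\<Psi>\<close> form a base of the topology induced by \<open>\<Psi>\<close>, this says that the
  diagonal map of \<open>\<Psi>\<close> is skeletal.\<close>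

definition skeletal_family :: "'b topology \<Rightarrow> ('b \<Rightarrow> real) set \<Rightarrow> bool" where
  "skeletal_family Y \<Psi> \<longleftrightarrow> (\<forall>U. openin Y U \<and> U \<noteq> {} \<longrightarrow>
     (\<exists>h\<in>\<Psi>. positive_set Y h \<noteq> {} \<and>
        (\<forall>h'\<in>\<Psi>. positive_set Y h \<inter> positive_set Y h' \<noteq> {} \<longrightarrow> U \<inter> positive_set Y h' \<noteq> {})))"

lemma openin_positive_set:
  "continuous_map Y euclideanreal h \<Longrightarrow> openin Y (positive_set Y h)"
  using openin_continuous_map_preimage[of Y euclideanreal h "{0<..}"]
  by (simp add: positive_set_def)

locale skeletal_system =
  fixes X :: "'a topology" and A :: "'i set" and r :: "'i rel"
    and S :: "'i \<Rightarrow> 'c topology" and p e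
  assumes generates: "skeletal_generation X A r S p e"
begin

lemma system: "inverse_system A r S p"
  and second_countable_member: "\<alpha> \<in> A \<Longrightarrow> second_countable (S \<alpha>)"
  and bonding_surj: "(\<alpha>, \<beta>) \<in> r \<Longrightarrow> p \<alpha> \<beta> ` topspace (S \<beta>) = topspace (S \<alpha>)"
  and sigma_complete: "sigma_complete A r"
  and sigma_continuous: "sigma_continuous_dense A r S p"
  and embedding: "embedding_map X (inverse_limit A r S p) e"
  and projection_surj: "\<alpha> \<in> A \<Longrightarrow> (\<lambda>x. e x \<alpha>) ` topspace X = topspace (S \<alpha>)"
  and factors: "continuous_map X euclideanreal f \<Longrightarrow> bounded (f ` topspace X) \<Longrightarrow>
        \<exists>\<alpha>\<in>A. map_prec X (S \<alpha>) euclideanreal (\<lambda>x. e x \<alpha>) f"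
  using generates unfolding skeletal_generation_def
  by (simp_all add: separable_metrizable_imp_second_countable)

lemma bonding_skeletal: "(\<alpha>, \<beta>) \<in> r \<Longrightarrow> skeletal_map (S \<beta>) (S \<alpha>) (p \<alpha> \<beta>)"
  using generates unfolding skeletal_generation_def by simp

lemma index_order: "directed_poset A r"
  and bonding_continuous: "(\<alpha>, \<beta>) \<in> r \<Longrightarrow> continuous_map (S \<beta>) (S \<alpha>) (p \<alpha> \<beta>)"
  using system unfolding inverse_system_def by simp_all

lemma order_in: "(\<alpha>, \<beta>) \<in> r \<Longrightarrow> \<alpha> \<in> A \<and> \<beta> \<in> A"
  and order_refl: "\<alpha> \<in> A \<Longrightarrow> (\<alpha>, \<alpha>) \<in> r"
  and order_trans: "(\<alpha>, \<beta>) \<in> r \<Longrightarrow> (\<beta>, \<gamma>) \<in> r \<Longrightarrow> (\<alpha>, \<gamma>) \<in> r"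
  using index_order unfolding directed_poset_def partial_order_on_def preorder_on_def
  by (auto simp: refl_on_def dest: transD)

lemma projection_continuous:
  assumes "\<alpha> \<in> A"
  shows "continuous_map X (S \<alpha>) (\<lambda>x. e x \<alpha>)"
proof -
  have "continuous_map X (inverse_limit A r S p) e"
    using embedding unfolding embedding_map_def
    by (auto dest: homeomorphic_imp_continuous_map simp: continuous_map_in_subtopology)
  then have "continuous_map X (product_topology S A) e"
    unfolding inverse_limit_def by (simp add: continuous_map_in_subtopology)
  then show ?thesis
    using assms by (simp add: continuous_map_componentwise)
qed

lemma projection_in: "\<alpha> \<in> A \<Longrightarrow> x \<in> topspace X \<Longrightarrow> e x \<alpha> \<in> topspace (S \<alpha>)"
  using projection_surj by blast

lemma bonding_projection:
  assumes "(\<alpha>, \<beta>) \<in> r" "x \<in> topspace X"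
  shows "p \<alpha> \<beta> (e x \<beta>) = e x \<alpha>"
proof -
  have "e ` topspace X \<subseteq> topspace (inverse_limit A r S p)"
    using embedding unfolding embedding_map_def
    by (auto dest!: homeomorphic_imp_surjective_map)
  then have "e x \<in> {x. \<forall>\<alpha> \<beta>. (\<alpha>, \<beta>) \<in> r \<longrightarrow> p \<alpha> \<beta> (x \<beta>) = x \<alpha>}"
    using assms(2) unfolding inverse_limit_def by auto
  then show ?thesis using assms(1) by simp
qed

lemma finite_upper_bound:
  assumes "finite C" "C \<subseteq> A"
  shows "\<exists>\<gamma>\<in>A. \<forall>\<alpha>\<in>C. (\<alpha>, \<gamma>) \<in> r"
  using assms
proof (induction C)
  case empty
  then show ?case using index_order unfolding directed_poset_def by auto
next
  case (insert a C)
  then obtain \<gamma> where \<gamma>: "\<gamma> \<in> A" "\<forall>\<alpha>\<in>C. (\<alpha>, \<gamma>) \<in> r" by auto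
  then obtain \<delta> where "\<delta> \<in> A" "(a, \<delta>) \<in> r" "(\<gamma>, \<delta>) \<in> r"
    using insert.prems index_order unfolding directed_poset_def by (meson insert_subset)
  then show ?case using \<gamma> order_trans by blast
qed

text \<open>A bounded bump function with positive set inside \<open>U\<close> factors through some
  \<open>S \<alpha>\<close>; the positive set of the factor is the required
  \<open>V\<close>.\<close>

lemma contains_preimage:
  assumes "completely_regular_space X" "openin X U" "U \<noteq> {}"
  shows "\<exists>\<alpha>\<in>A. \<exists>V. openin (S \<alpha>) V \<and> V \<noteq> {} \<and> {x \<in> topspace X. e x \<alpha> \<in> V} \<subseteq> U"
proof -
  obtain x where x: "x \<in> U" using assms(3) by blast
  obtain h where h: "continuous_map X euclideanreal h" "bounded (h ` topspace X)"
    "0 < h x" "{y \<in> topspace X. 0 < h y} \<subseteq> U"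
    using completely_regular_space_bump[OF assms(1,2) x] by metis
  obtain \<alpha> k where \<alpha>: "\<alpha> \<in> A" and hk: "\<forall>x\<in>topspace X. h x = k (e x \<alpha>)"
    and "continuous_map (subtopology (S \<alpha>) ((\<lambda>x. e x \<alpha>) ` topspace X))
          (subtopology euclideanreal (h ` topspace X)) k"
    using factors[OF h(1,2)] unfolding map_prec_def by blast
  then have "continuous_map (S \<alpha>) euclideanreal k"
    using projection_surj[OF \<alpha>] by (simp add: continuous_map_in_subtopology)
  then have V: "openin (S \<alpha>) (positive_set (S \<alpha>) k)" by (rule openin_positive_set)
  have "x \<in> topspace X" using x assms(2) openin_subset by blast
  then have "e x \<alpha> \<in> positive_set (S \<alpha>) k"
    using h(3) hk projection_in[OF \<alpha>] by (simp add: positive_set_def)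
  moreover have "{x \<in> topspace X. e x \<alpha> \<in> positive_set (S \<alpha>) k} \<subseteq> U"
    using h(4) hk by (auto simp: positive_set_def)
  ultimately show ?thesis using \<alpha> V by blast
qed

text \<open>Raises an open set to a larger index without changing its preimage in \<open>X\<close>;
  surjectivity of the bonding map keeps it non-empty.\<close>

lemma preimage_lift:
  assumes "(\<alpha>, \<beta>) \<in> r" "openin (S \<alpha>) V" "V \<noteq> {}"
  defines "V' \<equiv> {z \<in> topspace (S \<beta>). p \<alpha> \<beta> z \<in> V}"
  shows "openin (S \<beta>) V'" "V' \<noteq> {}" "\<And>x. x \<in> topspace X \<Longrightarrow> e x \<beta> \<in> V' \<longleftrightarrow> e x \<alpha> \<in> V"
proof -
  show "openin (S \<beta>) V'"
    unfolding V'_def using bonding_continuous[OF assms(1)] assms(2)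
    by (rule openin_continuous_map_preimage)
  have "V \<subseteq> p \<alpha> \<beta> ` topspace (S \<beta>)"
    using bonding_surj[OF assms(1)] openin_subset[OF assms(2)] by simp
  then show "V' \<noteq> {}" using assms(3) unfolding V'_def by blast
  fix x assume "x \<in> topspace X"
  then show "e x \<beta> \<in> V' \<longleftrightarrow> e x \<alpha> \<in> V"
    using projection_in order_in[OF assms(1)] bonding_projection[OF assms(1)]
    by (simp add: V'_def)
qed

text \<open>An open set of \<open>X\<close> contains the preimage of an open set of some \<open>S \<gamma>\<close> with \<open>\<alpha> \<le> \<gamma>\<close>, so its
  image in \<open>S \<alpha>\<close> contains the image of that set under the skeletal bonding map.\<close>

lemma projection_skeletal:
  assumes "completely_regular_space X" "\<alpha> \<in> A"
  shows "skeletal_map X (S \<alpha>) (\<lambda>x. e x \<alpha>)"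
  unfolding skeletal_map_alt
proof (intro conjI allI impI)
  show "continuous_map X (S \<alpha>) (\<lambda>x. e x \<alpha>)" using projection_continuous[OF assms(2)] .
  fix U assume U: "openin X U \<and> U \<noteq> {}"
  then obtain \<beta> V where \<beta>: "\<beta> \<in> A" and V: "openin (S \<beta>) V" "V \<noteq> {}"
    "{x \<in> topspace X. e x \<beta> \<in> V} \<subseteq> U"
    using contains_preimage[OF assms(1)] by blast
  obtain \<gamma> where \<gamma>: "(\<alpha>, \<gamma>) \<in> r" "(\<beta>, \<gamma>) \<in> r"
    using finite_upper_bound[of "{\<alpha>, \<beta>}"] assms(2) \<beta> by auto
  define V' where "V' = {z \<in> topspace (S \<gamma>). p \<beta> \<gamma> z \<in> V}"
  note V' = preimage_lift[OF \<gamma>(2) V(1,2), folded V'_def]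
  have "p \<alpha> \<gamma> ` V' \<subseteq> (\<lambda>x. e x \<alpha>) ` U"
  proof
    fix z assume "z \<in> p \<alpha> \<gamma> ` V'"
    then obtain v where v: "v \<in> V'" "z = p \<alpha> \<gamma> v" by blast
    then have "v \<in> (\<lambda>x. e x \<gamma>) ` topspace X"
      using projection_surj order_in[OF \<gamma>(1)] by (simp add: V'_def)
    then obtain x where x: "x \<in> topspace X" "v = e x \<gamma>" by blast
    then have "x \<in> U" using V'(3)[OF x(1)] v(1) V(3) by blast
    then show "z \<in> (\<lambda>x. e x \<alpha>) ` U"
      using bonding_projection[OF \<gamma>(1) x(1)] v(2) x(2) by blast
  qed
  moreover obtain W where "openin (S \<alpha>) W" "W \<noteq> {}"
    "\<forall>W'. openin (S \<alpha>) W' \<and> W' \<noteq> {} \<and> W' \<subseteq> W \<longrightarrow> p \<alpha> \<gamma> ` V' \<inter> W' \<noteq> {}"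
    using bonding_skeletal[OF \<gamma>(1), unfolded skeletal_map_alt, THEN conjunct2, THEN spec[of _ V']]
      V'(1,2) by blast
  ultimately show "\<exists>W. openin (S \<alpha>) W \<and> W \<noteq> {} \<and>
     (\<forall>W'. openin (S \<alpha>) W' \<and> W' \<noteq> {} \<and> W' \<subseteq> W \<longrightarrow> (\<lambda>x. e x \<alpha>) ` U \<inter> W' \<noteq> {})"
    by (intro exI[of _ W]) fast
qed

text \<open>By sigma-continuity \<open>S \<beta>\<close> is embedded in the limit of the sequence,
  where single coordinates already give a base.\<close>

lemma supremum_base:
  fixes s :: "nat \<Rightarrow> 'i"
  assumes s: "\<And>n. (s n, s (Suc n)) \<in> r" and \<beta>: "is_supremum A r (range s) \<beta>"
    and V: "openin (S \<beta>) V" "z \<in> V"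
  obtains n V' where "openin (S (s n)) V'" "p (s n) \<beta> z \<in> V'"
    "{z' \<in> topspace (S \<beta>). p (s n) \<beta> z' \<in> V'} \<subseteq> V"
proof -
  define L where "L = inverse_limit UNIV {(m, n). m \<le> n} (\<lambda>n. S (s n)) (\<lambda>m n. p (s m) (s n))"
  define \<epsilon> where "\<epsilon> = (\<lambda>x n. p (s n) \<beta> x)"
  have sA: "s n \<in> A" for n using order_in[OF s] by blast
  have "embedding_map (S \<beta>) L \<epsilon>"
    using sigma_continuous sA s \<beta> unfolding sigma_continuous_dense_def L_def \<epsilon>_def Let_def
    by blast
  then have hom: "homeomorphic_map (S \<beta>) (subtopology L (\<epsilon> ` topspace (S \<beta>))) \<epsilon>"
    unfolding embedding_map_def .
  then have "openin (subtopology L (\<epsilon> ` topspace (S \<beta>))) (\<epsilon> ` V)"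
    using V(1) homeomorphic_imp_open_map unfolding open_map_def by blast
  then obtain W where W: "openin L W" "\<epsilon> ` V = W \<inter> \<epsilon> ` topspace (S \<beta>)"
    unfolding openin_subtopology by blast
  have VS: "V \<subseteq> topspace (S \<beta>)" using V(1) by (rule openin_subset)
  have sr: "(s m, s n) \<in> r" if "m \<le> n" for m n
    using that by (induction n rule: dec_induct) (blast intro: order_refl sA order_trans s)+
  have "\<epsilon> z \<in> W" using W(2) V(2) by blast
  obtain n V' where V': "openin (S (s n)) V'" "\<epsilon> z n \<in> V'"
    "{z \<in> topspace L. z n \<in> V'} \<subseteq> W"
  proof (rule inverse_sequence_limit_base[where T = "\<lambda>n. S (s n)" and q = "\<lambda>m n. p (s m) (s n)",
        folded L_def])
    show "continuous_map (S (s n)) (S (s m)) (p (s m) (s n))" if "m \<le> n" for m n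
      using bonding_continuous[OF sr[OF that]] .
    show "openin L W" "\<epsilon> z \<in> W" by fact+
    fix n V' assume "openin (S (s n)) V'" "\<epsilon> z n \<in> V'" "{z \<in> topspace L. z n \<in> V'} \<subseteq> W"
    then show thesis by (rule that)
  qed
  have sub: "\<epsilon> ` topspace (S \<beta>) \<subseteq> topspace L"
    using homeomorphic_imp_surjective_map[OF hom] by (metis inf_le1 topspace_subtopology)
  show thesis
  proof (rule that[OF V'(1)])
    show "p (s n) \<beta> z \<in> V'" using V'(2) by (simp add: \<epsilon>_def)
    show "{z' \<in> topspace (S \<beta>). p (s n) \<beta> z' \<in> V'} \<subseteq> V"
    proof
      fix y assume y: "y \<in> {z' \<in> topspace (S \<beta>). p (s n) \<beta> z' \<in> V'}"
      then have "\<epsilon> y \<in> W" using V'(3) sub by (auto simp: \<epsilon>_def)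
      then have "\<epsilon> y \<in> \<epsilon> ` V" using W(2) y by blast
      moreover have "inj_on \<epsilon> (topspace (S \<beta>))"
        using homeomorphic_imp_injective_map[OF hom] .
      ultimately show "y \<in> V" using y VS inj_on_image_mem_iff[of \<epsilon> "topspace (S \<beta>)" y V] by simp
    qed
  qed
qed

end

subsection \<open>Transfer of skeletality through a common absolute\<close>

abbreviation real_maps :: "'b topology \<Rightarrow> ('b \<Rightarrow> real) set" where
  "real_maps Y \<equiv> {h. continuous_map Y euclideanreal h}"

text \<open>Testing finite subsets only makes closedness survive unions of chains, and lets a
  countable set be closed up in countably many rounds.\<close>

definition closed_under :: "('d set \<Rightarrow> 'd set) \<Rightarrow> 'd set \<Rightarrow> bool" where
  "closed_under c \<Psi> \<longleftrightarrow> (\<forall>F. finite F \<and> F \<subseteq> \<Psi> \<longrightarrow> c F \<subseteq> \<Psi>)"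

text \<open>Closure under \<open>c\<close> supplies the function \<open>h\<close> demanded by
  \<open>skeletal_family\<close>. Closure under \<open>min\<close> makes each intersection of two
  positive sets the positive set of a member, so that it is governed by one of the chosen
  indices.\<close>

lemma (in skeletal_system) ex_skeletal_closure_operation:
  fixes E :: "'e topology" and Y :: "'b topology"
  assumes regX: "completely_regular_space X" and regY: "completely_regular_space Y"
    and f: "tight_map E X f" and g: "tight_map E Y g"
  shows "\<exists>c. (\<forall>F. finite F \<and> F \<subseteq> real_maps Y \<longrightarrow> countable (c F) \<and> c F \<subseteq> real_maps Y) \<and>
    (\<forall>\<Psi>. countable \<Psi> \<and> \<Psi> \<noteq> {} \<and> \<Psi> \<subseteq> real_maps Y \<and> closed_under c \<Psi> \<and>
      (\<forall>h\<in>\<Psi>. \<forall>h'\<in>\<Psi>. (\<lambda>y. min (h y) (h' y)) \<in> \<Psi>) \<longrightarrow> skeletal_family Y \<Psi>)"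
proof -
  have surj: "f ` topspace E = topspace X" "g ` topspace E = topspace Y"
    using f g by (simp_all add: tight_map_def)
  have fX: "f x \<in> topspace X" if "x \<in> topspace E" for x
    using that surj(1) by blast

  \<comment> \<open>Inside \<open>E\<close>, the positive set of \<open>h\<close> contains the
    preimage of a non-empty open set of \<open>S \<alpha>\<close>. Functions without positive values
    are exempt.\<close>
  define good where "good h \<alpha> \<longleftrightarrow> (positive_set Y h \<noteq> {} \<longrightarrow>
      (\<exists>V. openin (S \<alpha>) V \<and> V \<noteq> {} \<and>
        (\<forall>x\<in>topspace E. e (f x) \<alpha> \<in> V \<longrightarrow> g x \<in> positive_set Y h)))" for h \<alpha>
  have ex_good: "\<exists>\<alpha>\<in>A. good h \<alpha>" if h: "h \<in> real_maps Y" for h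
  proof (cases "positive_set Y h = {}")
    case True
    then show ?thesis using index_order unfolding directed_poset_def good_def by blast
  next
    case False
    have oh: "openin Y (positive_set Y h)" using h openin_positive_set by blast
    obtain U where U: "openin X U" "U \<noteq> {}"
      "{x \<in> topspace E. f x \<in> U} \<subseteq> {x \<in> topspace E. g x \<in> positive_set Y h}"
      using tight_map_transfer[OF f g oh False] .
    obtain \<alpha> V where "\<alpha> \<in> A" and V: "openin (S \<alpha>) V" "V \<noteq> {}" "{x \<in> topspace X. e x \<alpha> \<in> V} \<subseteq> U"
      using contains_preimage[OF regX U(1,2)] by blast
    moreover have "good h \<alpha>"
      unfolding good_def using V U(3) fX by blast
    ultimately show ?thesis by blast
  qed
  have good_mono: "good h \<beta>" if good: "good h \<alpha>" and le: "(\<alpha>, \<beta>) \<in> r" for h \<alpha> \<beta>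
  proof (cases "positive_set Y h = {}")
    case True
    then show ?thesis by (simp add: good_def)
  next
    case False
    then obtain V where V: "openin (S \<alpha>) V" "V \<noteq> {}"
      "\<forall>x\<in>topspace E. e (f x) \<alpha> \<in> V \<longrightarrow> g x \<in> positive_set Y h"
      using good unfolding good_def by metis
    note V' = preimage_lift[OF le V(1,2)]
    show ?thesis
      unfolding good_def
    proof (intro impI exI conjI ballI)
      fix x assume x: "x \<in> topspace E" "e (f x) \<beta> \<in> {z \<in> topspace (S \<beta>). p \<alpha> \<beta> z \<in> V}"
      show "g x \<in> positive_set Y h" by (rule V(3)[rule_format, OF x(1)]) (use V'(3)[OF fX] x in blast)
    qed (rule V')+
  qed

  \<comment> \<open>The index \<open>a F\<close> is chosen by well-founded recursion along strict
    inclusion of finite sets; the last clause makes the choice monotone. Other sets \<open>F\<close>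
    are unconstrained.\<close>
  define P where "P a F \<alpha> \<longleftrightarrow> (finite F \<and> F \<subseteq> real_maps Y \<longrightarrow>
      \<alpha> \<in> A \<and> (\<forall>h\<in>F. good h \<alpha>) \<and> (\<forall>G. G \<subset> F \<longrightarrow> (a G, \<alpha>) \<in> r))" for a F \<alpha>
  have "\<exists>a. \<forall>F. P a F (a F)"
  proof (rule dependent_wf_choice[OF wf_finite_psubset])
    fix a b :: "('b \<Rightarrow> real) set \<Rightarrow> 'i" and F \<alpha>
    assume *: "\<And>G. (G, F) \<in> finite_psubset \<Longrightarrow> a G = b G"
    have "a G = b G" if "finite F" "G \<subset> F" for G
      using * that by (simp add: finite_psubset_def)
    then show "P a F \<alpha> = P b F \<alpha>"
      unfolding P_def by (cases "finite F") simp_all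
  next
    fix F and a :: "('b \<Rightarrow> real) set \<Rightarrow> 'i"
    assume *: "\<And>G. (G, F) \<in> finite_psubset \<Longrightarrow> P a G (a G)"
    show "\<exists>\<alpha>. P a F \<alpha>"
    proof (cases "finite F \<and> F \<subseteq> real_maps Y")
      case True
      obtain b where b: "\<And>h. h \<in> F \<Longrightarrow> b h \<in> A \<and> good h (b h)"
        using ex_good True by (metis subsetD)
      have "a G \<in> A" if "G \<subset> F" for G
        using *[of G] that True finite_subset[of G F] unfolding P_def finite_psubset_def by auto
      \<comment> \<open>The new index has to dominate only finitely many others: one for each
        \<open>h\<close> in \<open>F\<close> and one for each proper subset of
        \<open>F\<close>.\<close>
      then have "b ` F \<union> a ` {G. G \<subset> F} \<subseteq> A" using b by blast
      moreover have "{G. G \<subset> F} \<subseteq> Pow F" by blast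
      then have "finite {G. G \<subset> F}"
        using True by (meson finite_Pow_iff finite_subset)
      then have "finite (b ` F \<union> a ` {G. G \<subset> F})" using True by simp
      ultimately obtain \<gamma> where \<gamma>: "\<gamma> \<in> A" "\<forall>\<alpha>\<in>b ` F \<union> a ` {G. G \<subset> F}. (\<alpha>, \<gamma>) \<in> r"
        by (meson finite_upper_bound)
      have "good h \<gamma>" if "h \<in> F" for h
        using good_mono[of h "b h" \<gamma>] b[OF that] \<gamma>(2) that by blast
      then have "P a F \<gamma>"
        unfolding P_def using \<gamma> by simp
      then show ?thesis by blast
    next
      case False
      then have "P a F undefined" unfolding P_def by blast
      then show ?thesis by blast
    qed
  qed
  then obtain a where a: "\<And>F. P a F (a F)" by blast
  have aA: "a F \<in> A" and a_good: "h \<in> F \<Longrightarrow> good h (a F)"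
    if "finite F" "F \<subseteq> real_maps Y" for F h
    using a[of F] that unfolding P_def by blast+
  have a_mono: "(a G, a F) \<in> r" if "finite F" "F \<subseteq> real_maps Y" "G \<subseteq> F" for F G
    using a[of F] that order_refl[OF aA[OF that(1,2)]] unfolding P_def by (cases "G = F") auto

  \<comment> \<open>The converse direction to \<open>good\<close>: every non-empty open set of
    \<open>S (a F)\<close> contains, inside \<open>E\<close>, the positive set of a member of
    \<open>D\<close>.\<close>
  define coinitial where "coinitial F D \<longleftrightarrow> (\<forall>V. openin (S (a F)) V \<and> V \<noteq> {} \<longrightarrow>
      (\<exists>h\<in>D. positive_set Y h \<noteq> {} \<and>
        (\<forall>x\<in>topspace E. g x \<in> positive_set Y h \<longrightarrow> e (f x) (a F) \<in> V)))" for F D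
  have "\<exists>D. finite F \<and> F \<subseteq> real_maps Y \<longrightarrow> countable D \<and> D \<subseteq> real_maps Y \<and> coinitial F D" for F
  proof (cases "finite F \<and> F \<subseteq> real_maps Y")
    case True
    then have F: "a F \<in> A" using aA by blast
    \<comment> \<open>\<open>V\<close> is pulled back to \<open>X\<close>, transferred to
      \<open>Y\<close> through \<open>E\<close>, and there shrunk to the positive set of a bump
      function.\<close>
    have small: "\<exists>h\<in>real_maps Y. positive_set Y h \<noteq> {} \<and>
        (\<forall>x\<in>topspace E. g x \<in> positive_set Y h \<longrightarrow> e (f x) (a F) \<in> V)"
      if V: "openin (S (a F)) V" "V \<noteq> {}" for V
    proof -
      let ?U = "{x \<in> topspace X. e x (a F) \<in> V}"
      have U: "openin X ?U"
        using openin_continuous_map_preimage[OF projection_continuous[OF F] V(1)] .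
      have "V \<subseteq> (\<lambda>x. e x (a F)) ` topspace X"
        using openin_subset[OF V(1)] projection_surj[OF F] by simp
      then have "?U \<noteq> {}" using V(2) by blast
      obtain W where W: "openin Y W" "W \<noteq> {}"
        "{x \<in> topspace E. g x \<in> W} \<subseteq> {x \<in> topspace E. f x \<in> ?U}"
        using tight_map_transfer[OF g f U \<open>?U \<noteq> {}\<close>] .
      obtain y where y: "y \<in> W" using W(2) by blast
      obtain h where h: "continuous_map Y euclideanreal h" "0 < h y" "positive_set Y h \<subseteq> W"
        using completely_regular_space_bump[OF regY W(1) y] unfolding positive_set_def by metis
      have "y \<in> positive_set Y h"
        using h(2) y openin_subset[OF W(1)] by (auto simp: positive_set_def)
      then show ?thesis using h(1,3) W(3) by blast
    qed
    obtain \<B> where base: "countable \<B> \<and> (\<forall>V\<in>\<B>. openin (S (a F)) V) \<and>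
      (\<forall>U x. openin (S (a F)) U \<and> x \<in> U \<longrightarrow> (\<exists>V\<in>\<B>. x \<in> V \<and> V \<subseteq> U))"
      using second_countable_member[OF F, unfolded second_countable_def] ..
    note \<B> = base[THEN conjunct1] base[THEN conjunct2, THEN conjunct1]
      base[THEN conjunct2, THEN conjunct2]
    have "\<forall>V\<in>\<B> - {{}}. \<exists>h. h \<in> real_maps Y \<and> positive_set Y h \<noteq> {} \<and>
        (\<forall>x\<in>topspace E. g x \<in> positive_set Y h \<longrightarrow> e (f x) (a F) \<in> V)"
    proof
      fix V assume "V \<in> \<B> - {{}}"
      then have "openin (S (a F)) V" "V \<noteq> {}" using \<B>(2) by simp_all
      from small[OF this] show "\<exists>h. h \<in> real_maps Y \<and> positive_set Y h \<noteq> {} \<and>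
        (\<forall>x\<in>topspace E. g x \<in> positive_set Y h \<longrightarrow> e (f x) (a F) \<in> V)"
        by (simp only: Bex_def)
    qed
    from bchoice[OF this] obtain k where k: "\<forall>V\<in>\<B> - {{}}. k V \<in> real_maps Y \<and>
        positive_set Y (k V) \<noteq> {} \<and>
        (\<forall>x\<in>topspace E. g x \<in> positive_set Y (k V) \<longrightarrow> e (f x) (a F) \<in> V)" ..
    have "coinitial F (k ` (\<B> - {{}}))"
      unfolding coinitial_def
    proof (intro allI impI)
      fix U assume "openin (S (a F)) U \<and> U \<noteq> {}"
      then obtain V where V: "V \<in> \<B> - {{}}" "V \<subseteq> U" using \<B>(3) by fast
      then show "\<exists>h\<in>k ` (\<B> - {{}}). positive_set Y h \<noteq> {} \<and>
        (\<forall>x\<in>topspace E. g x \<in> positive_set Y h \<longrightarrow> e (f x) (a F) \<in> U)"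
        using k[rule_format, OF V(1)] by blast
    qed
    moreover have "countable (k ` (\<B> - {{}}))" "k ` (\<B> - {{}}) \<subseteq> real_maps Y"
      using \<B>(1) k by auto
    ultimately show ?thesis by blast
  qed blast
  then obtain c where c: "\<And>F. finite F \<Longrightarrow> F \<subseteq> real_maps Y \<Longrightarrow>
      countable (c F) \<and> c F \<subseteq> real_maps Y \<and> coinitial F (c F)"
    by metis

  have skeletal: "skeletal_family Y \<Psi>"
    if \<Psi>: "countable \<Psi>" "\<Psi> \<noteq> {}" "\<Psi> \<subseteq> real_maps Y" "closed_under c \<Psi>"
      and min: "\<forall>h\<in>\<Psi>. \<forall>h'\<in>\<Psi>. (\<lambda>y. min (h y) (h' y)) \<in> \<Psi>" for \<Psi>
  proof -
    \<comment> \<open>The finite sets \<open>F n\<close> increase and exhaust \<open>\<Psi>\<close>,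
      so the indices \<open>s n\<close> form a countable chain, which has a supremum.\<close>
    define F where "F n = from_nat_into \<Psi> ` {..n}" for n :: nat
    have F: "finite (F n)" "F n \<subseteq> \<Psi>" "F n \<subseteq> real_maps Y" for n
      using from_nat_into[OF \<Psi>(2)] \<Psi>(3) unfolding F_def by blast+
    define s where "s n = a (F n)" for n
    have s_mono: "(s m, s n) \<in> r" if "m \<le> n" for m n
      unfolding s_def by (rule a_mono[OF F(1,3)]) (use that in \<open>auto simp: F_def\<close>)
    have sA: "s n \<in> A" for n using order_in[OF s_mono[OF order.refl]] by blast
    have "range s \<in> Chains r"
      unfolding Chains_def using s_mono nat_le_linear by blast
    moreover have "range s \<subseteq> A" using sA by blast
    ultimately have "\<exists>\<beta>. is_supremum A r (range s) \<beta>"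
      using sigma_complete[unfolded sigma_complete_def, THEN spec[of _ "range s"]] by simp
    then obtain \<beta> where \<beta>: "is_supremum A r (range s) \<beta>" ..
    then have \<beta>A: "\<beta> \<in> A" and s\<beta>: "(s n, \<beta>) \<in> r" for n
      by (simp_all add: is_supremum_def)
    show ?thesis
      unfolding skeletal_family_def
    proof (intro allI impI)
      fix U assume "openin Y U \<and> U \<noteq> {}"
      then have U: "openin Y U" "U \<noteq> {}" by blast+
      \<comment> \<open>\<open>U\<close> is moved to \<open>X\<close>; the skeletal projection to
        \<open>S \<beta>\<close> then gives an open \<open>V\<close> in which the image of
        \<open>U'\<close> meets every non-empty open subset.\<close>
      obtain U' where U': "openin X U'" "U' \<noteq> {}"
        "{x \<in> topspace E. f x \<in> U'} \<subseteq> {x \<in> topspace E. g x \<in> U}"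
        using tight_map_transfer[OF f g U] .
      obtain V where V: "openin (S \<beta>) V" "V \<noteq> {}"
        "\<forall>W. openin (S \<beta>) W \<and> W \<noteq> {} \<and> W \<subseteq> V \<longrightarrow> (\<lambda>x. e x \<beta>) ` U' \<inter> W \<noteq> {}"
        using projection_skeletal[OF regX \<beta>A, unfolded skeletal_map_alt, THEN conjunct2,
            THEN spec[of _ U']] U'(1,2) by blast
      obtain z where z: "z \<in> V" using V(2) by blast
      \<comment> \<open>\<open>c\<close> speaks of the levels \<open>s n\<close>, not of
        \<open>\<beta>\<close>. A smaller open set coming from some \<open>s n\<close> can be
        refined by a function \<open>h\<close> in \<open>c (F n)\<close>.\<close>
      obtain n V\<^sub>n where V\<^sub>n: "openin (S (s n)) V\<^sub>n" "p (s n) \<beta> z \<in> V\<^sub>n"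
        "{z' \<in> topspace (S \<beta>). p (s n) \<beta> z' \<in> V\<^sub>n} \<subseteq> V"
        by (rule supremum_base[OF s_mono \<beta> V(1) z]) simp
      have "V\<^sub>n \<noteq> {}" using V\<^sub>n(2) by blast
      note lift_n = preimage_lift[OF s\<beta> V\<^sub>n(1) this]
      have "coinitial (F n) (c (F n))" using c[OF F(1,3)] by blast
      then obtain h where h: "h \<in> c (F n)" "positive_set Y h \<noteq> {}"
        "\<forall>x\<in>topspace E. g x \<in> positive_set Y h \<longrightarrow> e (f x) (s n) \<in> V\<^sub>n"
        using V\<^sub>n(1) \<open>V\<^sub>n \<noteq> {}\<close> unfolding coinitial_def s_def by metis
      have h\<Psi>: "h \<in> \<Psi>" using h(1) \<Psi>(4) F(1,2) unfolding closed_under_def by blast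
      have "U \<inter> positive_set Y h' \<noteq> {}"
        if h': "h' \<in> \<Psi>" "positive_set Y h \<inter> positive_set Y h' \<noteq> {}" for h'
      proof -
        \<comment> \<open>\<open>k\<close> occurs in some \<open>F m\<close>, so its positive set
          contains, inside \<open>E\<close>, the preimage of an open set \<open>V'\<close> of level
          \<open>s m\<close>.\<close>
        define k where "k = (\<lambda>y. min (h y) (h' y))"
        have k: "positive_set Y k = positive_set Y h \<inter> positive_set Y h'"
          unfolding k_def positive_set_def by auto
        have "k \<in> \<Psi>" unfolding k_def by (rule min[rule_format, OF h\<Psi> h'(1)])
        then obtain m where "from_nat_into \<Psi> m = k"
          using from_nat_into_surj[OF \<Psi>(1)] by blast
        then have "k \<in> F m" unfolding F_def by blast
        then have "good k (s m)" unfolding s_def by (rule a_good[OF F(1,3)])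
        moreover have "positive_set Y k \<noteq> {}" using h'(2) k by simp
        ultimately obtain V' where V': "openin (S (s m)) V'" "V' \<noteq> {}"
          "\<forall>x\<in>topspace E. e (f x) (s m) \<in> V' \<longrightarrow> g x \<in> positive_set Y k"
          unfolding good_def by metis
        define W where "W = {z \<in> topspace (S \<beta>). p (s m) \<beta> z \<in> V'}"
        note lift_m = preimage_lift[OF s\<beta> V'(1,2), folded W_def]
        \<comment> \<open>A point of \<open>W\<close> comes from some \<open>x\<close> in
          \<open>E\<close>. Then \<open>g x\<close> lies in the positive set of \<open>h\<close>,
          which was chosen so that \<open>f x\<close> projects into \<open>V\<close>.\<close>
        have "W \<subseteq> V"
        proof
          fix w assume w: "w \<in> W"
          then have "w \<in> (\<lambda>x. e x \<beta>) ` topspace X"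
            using projection_surj[OF \<beta>A] by (simp add: W_def)
          then obtain x where x: "x \<in> topspace E" "w = e (f x) \<beta>"
            unfolding surj(1)[symmetric] image_image by (rule imageE)
          then have "e (f x) (s m) \<in> V'" using lift_m(3)[OF fX[OF x(1)]] w by blast
          then have "g x \<in> positive_set Y h" using V'(3)[rule_format, OF x(1)] k by blast
          then have "e (f x) (s n) \<in> V\<^sub>n" by (rule h(3)[rule_format, OF x(1)])
          then show "w \<in> V" using lift_n(3)[OF fX[OF x(1)]] x(2) V\<^sub>n(3) by blast
        qed
        \<comment> \<open>By the choice of \<open>V\<close> some point of \<open>U'\<close> projects
          into \<open>W\<close>; a preimage of it in \<open>E\<close> is sent by \<open>g\<close>
          into both \<open>U\<close> and the positive set of \<open>h'\<close>.\<close>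
        then obtain x' where x': "x' \<in> U'" "e x' \<beta> \<in> W"
          using V(3)[THEN spec[of _ W]] lift_m(1,2) by blast
        then have "x' \<in> topspace X" using openin_subset[OF U'(1)] by blast
        then obtain x where x: "x \<in> topspace E" "x' = f x" using surj(1) by blast
        have "e (f x) (s m) \<in> V'" using lift_m(3)[OF fX[OF x(1)]] x'(2) x(2) by blast
        then have "g x \<in> positive_set Y h'" using V'(3)[rule_format, OF x(1)] k by blast
        moreover have "g x \<in> U" using U'(3) x x'(1) by blast
        ultimately show ?thesis by blast
      qed
      then show "\<exists>h\<in>\<Psi>. positive_set Y h \<noteq> {} \<and>
        (\<forall>h'\<in>\<Psi>. positive_set Y h \<inter> positive_set Y h' \<noteq> {} \<longrightarrow> U \<inter> positive_set Y h' \<noteq> {})"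
        using h\<Psi> h(2) by blast
    qed
  qed
  show ?thesis
  proof (intro exI[of _ c] conjI allI impI)
    fix F assume "finite F \<and> F \<subseteq> real_maps Y"
    then show "countable (c F)" "c F \<subseteq> real_maps Y" using c[of F] by simp_all
  next
    fix \<Psi> assume "countable \<Psi> \<and> \<Psi> \<noteq> {} \<and> \<Psi> \<subseteq> real_maps Y \<and> closed_under c \<Psi> \<and>
      (\<forall>h\<in>\<Psi>. \<forall>h'\<in>\<Psi>. (\<lambda>y. min (h y) (h' y)) \<in> \<Psi>)"
    then show "skeletal_family Y \<Psi>" by (elim conjE) (rule skeletal)
  qed
qed

subsection \<open>Systems of function families\<close>

text \<open>Closure under these operations makes the positive sets of a set of functions a base of the
  topology that it induces.\<close>

definition lattice_ops :: "('b \<Rightarrow> real) set \<Rightarrow> ('b \<Rightarrow> real) set" where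
  "lattice_ops F = {\<lambda>_. 1} \<union> (\<lambda>(h, h') y. min (h y) (h' y)) ` (F \<times> F) \<union>
     (\<lambda>(h, q) y. h y - of_rat q) ` (F \<times> UNIV) \<union> (\<lambda>(h, q) y. of_rat q - h y) ` (F \<times> UNIV)"

lemma countable_lattice_ops: "countable F \<Longrightarrow> countable (lattice_ops F)"
  unfolding lattice_ops_def by simp

lemma lattice_ops_real_maps:
  assumes "F \<subseteq> real_maps Y"
  shows "lattice_ops F \<subseteq> real_maps Y"
proof
  have F: "continuous_map Y euclideanreal h" if "h \<in> F" for h using assms that by blast
  fix k assume "k \<in> lattice_ops F"
  then consider "k = (\<lambda>_. 1)" | h h' where "h \<in> F" "h' \<in> F" "k = (\<lambda>y. min (h y) (h' y))"
    | h q where "h \<in> F" "k = (\<lambda>y. h y - of_rat q)" | h q where "h \<in> F" "k = (\<lambda>y. of_rat q - h y)"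
    unfolding lattice_ops_def by auto
  then show "k \<in> real_maps Y"
    by cases (simp_all add: F continuous_map_real_min continuous_map_diff)
qed

lemma closed_under_lattice_ops:
  assumes "closed_under c \<Psi>" "\<forall>F. finite F \<longrightarrow> lattice_ops F \<subseteq> c F"
  shows "(\<lambda>_. 1) \<in> \<Psi>"
    and "h \<in> \<Psi> \<Longrightarrow> h' \<in> \<Psi> \<Longrightarrow> (\<lambda>y. min (h y) (h' y)) \<in> \<Psi>"
    and "h \<in> \<Psi> \<Longrightarrow> (\<lambda>y. h y - of_rat q) \<in> \<Psi>"
    and "h \<in> \<Psi> \<Longrightarrow> (\<lambda>y. of_rat q - h y) \<in> \<Psi>"
proof -
  have sub: "lattice_ops F \<subseteq> \<Psi>" if "finite F" "F \<subseteq> \<Psi>" for F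
    using assms(1)[unfolded closed_under_def, rule_format, of F] assms(2)[rule_format, of F] that by simp
  show "(\<lambda>_. 1) \<in> \<Psi>" using sub[of "{}"] by (simp add: lattice_ops_def)
  show "(\<lambda>y. min (h y) (h' y)) \<in> \<Psi>" if "h \<in> \<Psi>" "h' \<in> \<Psi>"
    using sub[of "{h, h'}"] that by (simp add: lattice_ops_def)
  show "(\<lambda>y. h y - of_rat q) \<in> \<Psi>" "(\<lambda>y. of_rat q - h y) \<in> \<Psi>" if "h \<in> \<Psi>"
    using sub[of "{h}"] that by (auto simp: lattice_ops_def)
qed

text \<open>The stages of the iteration increase, so a finite subset of their union lies in one
  stage, and its value under \<open>c\<close> in the next.\<close>

lemma ex_closed_under:
  assumes c: "\<And>F. finite F \<Longrightarrow> F \<subseteq> M \<Longrightarrow> countable (c F) \<and> c F \<subseteq> M"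
    and \<Phi>: "countable \<Phi>" "\<Phi> \<subseteq> M"
  shows "\<exists>\<Psi>. \<Phi> \<subseteq> \<Psi> \<and> countable \<Psi> \<and> \<Psi> \<subseteq> M \<and> closed_under c \<Psi>"
proof -
  define T where "T \<Phi> = \<Phi> \<union> \<Union> (c ` {F. finite F \<and> F \<subseteq> \<Phi>})" for \<Phi>
  define \<Psi> where "\<Psi> n = (T ^^ n) \<Phi>" for n
  have step: "\<Psi> (Suc n) = T (\<Psi> n)" for n by (simp add: \<Psi>_def)
  have \<Psi>: "countable (\<Psi> n) \<and> \<Psi> n \<subseteq> M" for n
  proof (induction n)
    case 0
    show ?case using \<Phi> by (simp add: \<Psi>_def)
  next
    case (Suc n)
    let ?\<F> = "{F. finite F \<and> F \<subseteq> \<Psi> n}"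
    have cF: "countable (c F)" "c F \<subseteq> M" if "F \<in> ?\<F>" for F
      using c[of F] that Suc.IH by auto
    have "countable ?\<F>"
      using Suc.IH countable_Collect_finite_subset by blast
    then have "countable (\<Union> (c ` ?\<F>))" using cF(1) by (rule countable_UN)
    moreover have "\<Union> (c ` ?\<F>) \<subseteq> M" using cF(2) by (rule UN_least)
    ultimately show ?case using Suc.IH by (simp add: step T_def)
  qed
  have "incseq \<Psi>" unfolding incseq_Suc_iff by (simp add: step T_def)
  have "closed_under c (\<Union> (range \<Psi>))"
    unfolding closed_under_def
  proof (intro allI impI)
    fix F assume F: "finite F \<and> F \<subseteq> \<Union> (range \<Psi>)"
    have "subset.chain UNIV (range \<Psi>)"
      unfolding subset_chain_def using \<open>incseq \<Psi>\<close> nat_le_linear by (simp add: incseq_def) metis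
    then obtain B where "B \<in> range \<Psi>" "F \<subseteq> B"
      using F finite_subset_Union_chain[of F "range \<Psi>" UNIV] by blast
    then obtain n where "F \<subseteq> \<Psi> n" by blast
    then have "c F \<subseteq> \<Psi> (Suc n)" using F unfolding step T_def by blast
    then show "c F \<subseteq> \<Union> (range \<Psi>)" by blast
  qed
  moreover have "\<Phi> \<subseteq> \<Union> (range \<Psi>)"
    by (rule order_trans[OF _ UN_upper[of 0]]) (simp_all add: \<Psi>_def)
  moreover have "countable (\<Union> (range \<Psi>))" "\<Union> (range \<Psi>) \<subseteq> M"
    using \<Psi> by auto
  ultimately show ?thesis by (intro exI[of _ "\<Union> (range \<Psi>)"]) simp
qed

section \<open>Diagonal maps of countable families and their images\<close>

definition diag :: "('b \<Rightarrow> real) set \<Rightarrow> 'b \<Rightarrow> nat \<Rightarrow> real" where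
  "diag \<Psi> y n = from_nat_into \<Psi> n y"

text \<open>Numbering the functions by \<open>from_nat_into\<close> places all images in the
  countable power of the line, so that the members of the system share one type.\<close>

definition image_space :: "'b topology \<Rightarrow> ('b \<Rightarrow> real) set \<Rightarrow> (nat \<Rightarrow> real) topology" where
  "image_space Y \<Psi> = subtopology euclidean (diag \<Psi> ` topspace Y)"

text \<open>The projection from the coordinates \<open>\<Psi>\<close> to a subfamily
  \<open>\<Phi>\<close>, rewritten for the two numberings: the function numbered \<open>n\<close> in
  \<open>\<Phi>\<close> is looked up at its number in \<open>\<Psi>\<close>.\<close>

definition bonding :: "('b \<Rightarrow> real) set \<Rightarrow> ('b \<Rightarrow> real) set \<Rightarrow> (nat \<Rightarrow> real) \<Rightarrow> nat \<Rightarrow> real" where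
  "bonding \<Phi> \<Psi> z n = z (to_nat_on \<Psi> (from_nat_into \<Phi> n))"

lemma topspace_image_space [simp]: "topspace (image_space Y \<Psi>) = diag \<Psi> ` topspace Y"
  by (simp add: image_space_def)

lemma diag_to_nat_on: "countable \<Psi> \<Longrightarrow> h \<in> \<Psi> \<Longrightarrow> diag \<Psi> y (to_nat_on \<Psi> h) = h y"
  by (simp add: diag_def)

lemma diag_eqI: "\<Psi> \<noteq> {} \<Longrightarrow> (\<And>h. h \<in> \<Psi> \<Longrightarrow> h y = h y') \<Longrightarrow> diag \<Psi> y = diag \<Psi> y'"
  by (simp add: diag_def from_nat_into fun_eq_iff)

lemma bonding_diag:
  "countable \<Psi> \<Longrightarrow> \<Phi> \<noteq> {} \<Longrightarrow> \<Phi> \<subseteq> \<Psi> \<Longrightarrow> bonding \<Phi> \<Psi> (diag \<Psi> y) = diag \<Phi> y"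
  by (rule ext) (simp add: bonding_def diag_def from_nat_into subset_iff)

lemma continuous_map_funI:
  fixes f :: "'a \<Rightarrow> nat \<Rightarrow> real"
  assumes "\<And>n. continuous_map X euclideanreal (\<lambda>x. f x n)"
  shows "continuous_map X euclidean f"
  using assms unfolding euclidean_product_topology[symmetric] continuous_map_componentwise_UNIV by simp

lemma continuous_map_image_space_coordinate:
  "continuous_map (image_space Y \<Psi>) euclideanreal (\<lambda>z. z n)"
  unfolding image_space_def by (intro continuous_map_from_subtopology) simp

lemma continuous_map_diag:
  assumes "\<Psi> \<noteq> {}" "\<Psi> \<subseteq> real_maps Y"
  shows "continuous_map Y (image_space Y \<Psi>) (diag \<Psi>)"
proof -
  have "continuous_map Y euclideanreal (from_nat_into \<Psi> n)" for n
    using from_nat_into[OF assms(1)] assms(2) by blast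
  then have "continuous_map Y euclidean (diag \<Psi>)"
    by (intro continuous_map_funI) (simp add: diag_def)
  then show ?thesis
    unfolding image_space_def by (simp add: continuous_map_in_subtopology)
qed

lemma continuous_map_bonding:
  assumes "countable \<Psi>" "\<Phi> \<noteq> {}" "\<Phi> \<subseteq> \<Psi>"
  shows "continuous_map (image_space Y \<Psi>) (image_space Y \<Phi>) (bonding \<Phi> \<Psi>)"
proof -
  have "continuous_map (image_space Y \<Psi>) euclidean (bonding \<Phi> \<Psi>)"
    by (intro continuous_map_funI)
      (simp add: bonding_def continuous_map_image_space_coordinate)
  moreover have "bonding \<Phi> \<Psi> ` diag \<Psi> ` topspace Y \<subseteq> diag \<Phi> ` topspace Y"
    using bonding_diag[OF assms] by auto
  ultimately show ?thesis
    unfolding image_space_def[of Y \<Phi>]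
    by (simp add: continuous_map_in_subtopology image_subset_iff_funcset)
qed

section \<open>The inverse system of images of \<open>Y\<close>, indexed by closed countable
  families\<close>

locale skeletal_families =
  fixes Y :: "'b topology" and c :: "('b \<Rightarrow> real) set \<Rightarrow> ('b \<Rightarrow> real) set"
  assumes tychonoff: "tychonoff_space Y"
    and c: "\<And>F. finite F \<Longrightarrow> F \<subseteq> real_maps Y \<Longrightarrow> countable (c F) \<and> c F \<subseteq> real_maps Y"
    and c_ops: "\<forall>F. finite F \<longrightarrow> lattice_ops F \<subseteq> c F"
    and skeletal: "\<And>\<Psi>. countable \<Psi> \<Longrightarrow> \<Psi> \<subseteq> real_maps Y \<Longrightarrow> closed_under c \<Psi> \<Longrightarrow> skeletal_family Y \<Psi>"
begin

definition index :: "('b \<Rightarrow> real) set set" where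
  "index = {\<Psi>. countable \<Psi> \<and> \<Psi> \<subseteq> real_maps Y \<and> closed_under c \<Psi>}"

definition inclusion :: "('b \<Rightarrow> real) set rel" where
  "inclusion = {(\<Phi>, \<Psi>). \<Phi> \<in> index \<and> \<Psi> \<in> index \<and> \<Phi> \<subseteq> \<Psi>}"

text \<open>Non-emptiness is automatic: \<open>lattice_ops {}\<close> already contains the constant
  1.\<close>

lemma indexD:
  assumes "\<Psi> \<in> index"
  shows "countable \<Psi>" "\<Psi> \<subseteq> real_maps Y" "closed_under c \<Psi>" "\<Psi> \<noteq> {}"
  using assms closed_under_lattice_ops(1)[OF _ c_ops, of \<Psi>] by (auto simp: index_def)

lemmas index_ops = closed_under_lattice_ops[OF indexD(3) c_ops]

lemma inclusionD:
  assumes "(\<Phi>, \<Psi>) \<in> inclusion"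
  shows "\<Phi> \<in> index" "\<Psi> \<in> index" "\<Phi> \<subseteq> \<Psi>"
  using assms by (auto simp: inclusion_def)

lemma bonding_inclusion:
  assumes "(\<Phi>, \<Psi>) \<in> inclusion"
  shows "bonding \<Phi> \<Psi> (diag \<Psi> y) = diag \<Phi> y"
  using bonding_diag[OF indexD(1)[OF inclusionD(2)] indexD(4)[OF inclusionD(1)] inclusionD(3)] assms
  by blast

lemma continuous_map_bonding_inclusion:
  assumes "(\<Phi>, \<Psi>) \<in> inclusion"
  shows "continuous_map (image_space Y \<Psi>) (image_space Y \<Phi>) (bonding \<Phi> \<Psi>)"
  using continuous_map_bonding[OF indexD(1)[OF inclusionD(2)] indexD(4)[OF inclusionD(1)] inclusionD(3)]
    assms by blast

lemma ex_index:
  assumes "countable \<Phi>" "\<Phi> \<subseteq> real_maps Y"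
  obtains \<Psi> where "\<Psi> \<in> index" "\<Phi> \<subseteq> \<Psi>"
proof -
  have "\<exists>\<Psi>. \<Phi> \<subseteq> \<Psi> \<and> countable \<Psi> \<and> \<Psi> \<subseteq> real_maps Y \<and> closed_under c \<Psi>"
    by (rule ex_closed_under[OF c assms])
  then show thesis using that by (auto simp: index_def)
qed

text \<open>A finite subset of the union of a chain lies in one member, which is closed. Suprema of
  countable chains are therefore plain unions.\<close>

lemma index_Union:
  assumes "C \<subseteq> index" "countable C" "C \<noteq> {}" "\<forall>\<Phi>\<in>C. \<forall>\<Psi>\<in>C. \<Phi> \<subseteq> \<Psi> \<or> \<Psi> \<subseteq> \<Phi>"
  shows "\<Union>C \<in> index"
proof -
  have "closed_under c (\<Union>C)"
    unfolding closed_under_def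
  proof (intro allI impI)
    fix F assume F: "finite F \<and> F \<subseteq> \<Union>C"
    have "subset.chain UNIV C" using assms(4) by (simp add: subset_chain_def)
    then obtain B where B: "B \<in> C" "F \<subseteq> B"
      using F finite_subset_Union_chain[of F C UNIV] assms(3) by blast
    then have "closed_under c B" using assms(1) indexD(3) by blast
    then show "c F \<subseteq> \<Union>C" using B F unfolding closed_under_def by blast
  qed
  moreover have "countable (\<Union>C)"
    using countable_UN[OF assms(2), of "\<lambda>\<Psi>. \<Psi>"] assms(1) indexD(1) by auto
  moreover have "\<Union>C \<subseteq> real_maps Y"
    using assms(1) indexD(2) by (intro Union_least) (rule indexD(2), auto)
  ultimately show ?thesis by (simp add: index_def)
qed

text \<open>A basic neighbourhood restricts finitely many coordinates. Lying strictly between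
  rationals \<open>a\<close> and \<open>b\<close> is positivity of
  \<open>min (k - a) (b - k)\<close>, and finitely many such conditions are merged by
  \<open>min\<close>.\<close>

lemma image_space_base:
  assumes \<Psi>: "\<Psi> \<in> index" and W: "openin (image_space Y \<Psi>) W"
    and y: "y \<in> topspace Y" "diag \<Psi> y \<in> W"
  shows "\<exists>h\<in>\<Psi>. 0 < h y \<and> (\<forall>y'\<in>topspace Y. 0 < h y' \<longrightarrow> diag \<Psi> y' \<in> W)"
proof -
  obtain W' where W': "open W'" "W = W' \<inter> diag \<Psi> ` topspace Y"
    using W unfolding image_space_def openin_subtopology by auto
  have "openin (product_topology (\<lambda>_. euclideanreal) UNIV) W'"
    using W'(1) by (simp add: euclidean_product_topology)
  moreover have "diag \<Psi> y \<in> W'" using y(2) W'(2) by blast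
  ultimately obtain U where U: "finite {n. U n \<noteq> UNIV}" "\<forall>n. open (U n)"
    "diag \<Psi> y \<in> Pi\<^sub>E UNIV U" "Pi\<^sub>E UNIV U \<subseteq> W'"
    unfolding openin_product_topology_alt by auto
  have single: "\<exists>h\<in>\<Psi>. 0 < h y \<and> (\<forall>y'. 0 < h y' \<longrightarrow> diag \<Psi> y' n \<in> U n)" for n
  proof -
    define k where "k = from_nat_into \<Psi> n"
    have k: "k \<in> \<Psi>" unfolding k_def by (rule from_nat_into[OF indexD(4)[OF \<Psi>]])
    have "k y \<in> U n" using U(3) unfolding k_def diag_def[symmetric] by (simp add: PiE_iff)
    then obtain \<epsilon> where \<epsilon>: "\<epsilon> > 0" "ball (k y) \<epsilon> \<subseteq> U n"
      using U(2) open_contains_ball by metis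
    obtain a where a: "k y - \<epsilon> < of_rat a" "of_rat a < k y"
      using of_rat_dense[of "k y - \<epsilon>" "k y"] \<epsilon>(1) by auto
    obtain b where b: "k y < of_rat b" "of_rat b < k y + \<epsilon>"
      using of_rat_dense[of "k y" "k y + \<epsilon>"] \<epsilon>(1) by auto
    have "(\<lambda>y. min (k y - of_rat a) (of_rat b - k y)) \<in> \<Psi>"
      using index_ops(2)[OF \<Psi> index_ops(3)[OF \<Psi> k] index_ops(4)[OF \<Psi> k]] .
    moreover have "diag \<Psi> y' n \<in> U n" if "0 < min (k y' - of_rat a) (of_rat b - k y')" for y'
    proof -
      have "k y' \<in> ball (k y) \<epsilon>" using that a b by (auto simp: dist_real_def)
      then show ?thesis using \<epsilon>(2) unfolding k_def diag_def by blast
    qed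
    ultimately show ?thesis using a b by (intro bexI) auto
  qed
  have "\<exists>h\<in>\<Psi>. 0 < h y \<and> (\<forall>y'. 0 < h y' \<longrightarrow> (\<forall>n\<in>J. diag \<Psi> y' n \<in> U n))" if "finite J" for J
    using that
  proof (induction J)
    case empty
    \<comment> \<open>Without restrictions the constant 1 serves, being positive everywhere.\<close>
    show ?case by (rule bexI[OF _ index_ops(1)[OF \<Psi>]]) simp
  next
    case (insert n J)
    then obtain h where h: "h \<in> \<Psi>" "0 < h y" "\<forall>y'. 0 < h y' \<longrightarrow> (\<forall>n\<in>J. diag \<Psi> y' n \<in> U n)"
      by blast
    obtain k where k: "k \<in> \<Psi>" "0 < k y" "\<forall>y'. 0 < k y' \<longrightarrow> diag \<Psi> y' n \<in> U n"
      using single by blast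
    show ?case
      by (rule bexI[OF _ index_ops(2)[OF \<Psi> h(1) k(1)]]) (use h k in simp)
  qed
  from this[OF U(1)] obtain h where h: "h \<in> \<Psi>" "0 < h y"
    "\<forall>y'. 0 < h y' \<longrightarrow> (\<forall>n\<in>{n. U n \<noteq> UNIV}. diag \<Psi> y' n \<in> U n)"
    by blast
  have "diag \<Psi> y' \<in> W" if y': "y' \<in> topspace Y" "0 < h y'" for y'
  proof -
    have "diag \<Psi> y' n \<in> U n" for n
      using h(3) y'(2) by (cases "U n = UNIV") auto
    then have "diag \<Psi> y' \<in> W'" using U(4) by (auto simp: PiE_iff)
    then show ?thesis using W'(2) y'(1) by blast
  qed
  then show ?thesis using h by blast
qed

text \<open>Coordinate \<open>h\<close> turns the positive set given by
  \<open>skeletal_family\<close> into an open set \<open>V\<close> of the image. A non-empty open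
  \<open>W\<close> inside \<open>V\<close> contains the image of the positive set of some
  \<open>h'\<close> that meets that of \<open>h\<close>, hence meets \<open>U\<close>.\<close>

lemma skeletal_map_diag:
  assumes \<Psi>: "\<Psi> \<in> index"
  shows "skeletal_map Y (image_space Y \<Psi>) (diag \<Psi>)"
  unfolding skeletal_map_alt
proof (intro conjI allI impI)
  note \<Psi>' = indexD[OF \<Psi>]
  show "continuous_map Y (image_space Y \<Psi>) (diag \<Psi>)"
    by (rule continuous_map_diag[OF \<Psi>'(4,2)])
  fix U assume U: "openin Y U \<and> U \<noteq> {}"
  obtain h where h: "h \<in> \<Psi>" "positive_set Y h \<noteq> {}"
    "\<forall>h'\<in>\<Psi>. positive_set Y h \<inter> positive_set Y h' \<noteq> {} \<longrightarrow> U \<inter> positive_set Y h' \<noteq> {}"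
    using skeletal[OF \<Psi>'(1-3), unfolded skeletal_family_def, THEN spec[of _ U]] U by blast
  define V where "V = positive_set (image_space Y \<Psi>) (\<lambda>z. z (to_nat_on \<Psi> h))"
  have V: "diag \<Psi> y \<in> V \<longleftrightarrow> 0 < h y" if "y \<in> topspace Y" for y
    using that diag_to_nat_on[OF \<Psi>'(1) h(1)] by (simp add: V_def positive_set_def)
  have "openin (image_space Y \<Psi>) V"
    unfolding V_def by (rule openin_positive_set[OF continuous_map_image_space_coordinate])
  moreover have "V \<noteq> {}"
    using h(2) V by (auto simp: positive_set_def)
  moreover have "diag \<Psi> ` U \<inter> W \<noteq> {}"
    if W: "openin (image_space Y \<Psi>) W \<and> W \<noteq> {} \<and> W \<subseteq> V" for W
  proof -
    have "W \<subseteq> diag \<Psi> ` topspace Y" using W openin_subset by fastforce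
    then obtain y where y: "y \<in> topspace Y" "diag \<Psi> y \<in> W" using W by auto
    obtain h' where h': "h' \<in> \<Psi>" "0 < h' y" "\<forall>y'\<in>topspace Y. 0 < h' y' \<longrightarrow> diag \<Psi> y' \<in> W"
      using image_space_base[OF \<Psi> _ y] W by blast
    have "y \<in> positive_set Y h \<inter> positive_set Y h'"
      using V[OF y(1)] y W h'(2) by (auto simp: positive_set_def)
    then obtain y' where "y' \<in> U" "y' \<in> positive_set Y h'" using h(3) h'(1) by blast
    then show ?thesis using h'(3) by (auto simp: positive_set_def)
  qed
  ultimately show "\<exists>V. openin (image_space Y \<Psi>) V \<and> V \<noteq> {} \<and>
     (\<forall>W. openin (image_space Y \<Psi>) W \<and> W \<noteq> {} \<and> W \<subseteq> V \<longrightarrow> diag \<Psi> ` U \<inter> W \<noteq> {})"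
    by (intro exI[of _ V]) simp
qed

text \<open>Since \<open>bonding \<Phi> \<Psi>\<close> after \<open>diag \<Psi>\<close> is
  \<open>diag \<Phi>\<close>, the image of \<open>U\<close> is the image under
  \<open>diag \<Phi>\<close> of an open subset of \<open>Y\<close>.\<close>

lemma skeletal_map_bonding:
  assumes "(\<Phi>, \<Psi>) \<in> inclusion"
  shows "skeletal_map (image_space Y \<Psi>) (image_space Y \<Phi>) (bonding \<Phi> \<Psi>)"
  unfolding skeletal_map_def
proof (intro conjI allI impI)
  show "continuous_map (image_space Y \<Psi>) (image_space Y \<Phi>) (bonding \<Phi> \<Psi>)"
    by (rule continuous_map_bonding_inclusion[OF assms])
  fix U assume U: "openin (image_space Y \<Psi>) U \<and> U \<noteq> {}"
  note \<Psi> = inclusionD(2)[OF assms]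
  define U' where "U' = {y \<in> topspace Y. diag \<Psi> y \<in> U}"
  have sub: "U \<subseteq> diag \<Psi> ` topspace Y" using U openin_subset by fastforce
  have "openin Y U'"
    unfolding U'_def using U continuous_map_diag[OF indexD(4,2)[OF \<Psi>]]
    by (blast intro: openin_continuous_map_preimage)
  moreover have "U' \<noteq> {}" using sub U unfolding U'_def by blast
  moreover have "diag \<Phi> ` U' = bonding \<Phi> \<Psi> ` U"
  proof -
    have "U = diag \<Psi> ` U'" using sub unfolding U'_def by blast
    then show ?thesis by (simp add: image_image bonding_inclusion[OF assms])
  qed
  ultimately show "image_space Y \<Phi> interior_of (image_space Y \<Phi> closure_of (bonding \<Phi> \<Psi> ` U)) \<noteq> {}"
    using skeletal_map_diag[OF inclusionD(1)[OF assms], unfolded skeletal_map_def] by metis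
qed

lemma inverse_system_index: "inverse_system index inclusion (image_space Y) bonding"
  unfolding inverse_system_def
proof (intro conjI allI impI ballI)
  have "\<exists>\<gamma>\<in>index. (\<Phi>, \<gamma>) \<in> inclusion \<and> (\<Psi>, \<gamma>) \<in> inclusion" if "\<Phi> \<in> index" "\<Psi> \<in> index" for \<Phi> \<Psi>
  proof -
    \<comment> \<open>The union of two closed families need not be closed; an upper bound is a
      closed countable family containing it.\<close>
    have "countable (\<Phi> \<union> \<Psi>)" "\<Phi> \<union> \<Psi> \<subseteq> real_maps Y" using that indexD(1,2) by simp_all
    then obtain \<gamma> where "\<gamma> \<in> index" "\<Phi> \<union> \<Psi> \<subseteq> \<gamma>" by (rule ex_index)
    then show ?thesis using that by (auto simp: inclusion_def)
  qed
  moreover have "index \<noteq> {}" using ex_index[of "{}"] by auto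
  moreover have "partial_order_on index inclusion"
    unfolding partial_order_on_def preorder_on_def
    by (auto simp: inclusion_def refl_on_def trans_def antisym_def)
  ultimately show "directed_poset index inclusion" by (simp add: directed_poset_def)
next
  fix \<Phi> \<Psi> assume "(\<Phi>, \<Psi>) \<in> inclusion"
  then show "continuous_map (image_space Y \<Psi>) (image_space Y \<Phi>) (bonding \<Phi> \<Psi>)"
    by (rule continuous_map_bonding_inclusion)
next
  fix \<Psi> x assume "\<Psi> \<in> index" "x \<in> topspace (image_space Y \<Psi>)"
  then show "bonding \<Psi> \<Psi> x = x" using bonding_inclusion[of \<Psi> \<Psi>] by (auto simp: inclusion_def)
next
  fix \<alpha> \<beta> \<gamma> x
  assume *: "(\<alpha>, \<beta>) \<in> inclusion \<and> (\<beta>, \<gamma>) \<in> inclusion" "x \<in> topspace (image_space Y \<gamma>)"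
  then have "(\<alpha>, \<gamma>) \<in> inclusion" by (auto simp: inclusion_def)
  then show "bonding \<alpha> \<gamma> x = bonding \<alpha> \<beta> (bonding \<beta> \<gamma> x)"
    using * by (auto simp: bonding_inclusion)
qed

lemma is_supremum_Union:
  assumes "C \<subseteq> index" "countable C" "C \<noteq> {}" "\<forall>\<Phi>\<in>C. \<forall>\<Psi>\<in>C. \<Phi> \<subseteq> \<Psi> \<or> \<Psi> \<subseteq> \<Phi>"
  shows "is_supremum index inclusion C (\<Union>C)"
  using index_Union[OF assms] assms(1) by (auto simp: is_supremum_def inclusion_def)

lemma sigma_complete_index: "sigma_complete index inclusion"
  unfolding sigma_complete_def
proof (intro allI impI)
  fix C assume C: "C \<subseteq> index \<and> C \<noteq> {} \<and> countable C \<and> C \<in> Chains inclusion"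
  then have "\<forall>\<Phi>\<in>C. \<forall>\<Psi>\<in>C. \<Phi> \<subseteq> \<Psi> \<or> \<Psi> \<subseteq> \<Phi>"
    by (auto simp: Chains_def inclusion_def)
  then show "\<exists>\<beta>. is_supremum index inclusion C \<beta>" using is_supremum_Union[of C] C by blast
qed

text \<open>Each function of \<open>\<beta>\<close> is a coordinate of some level, so the levels
  together induce the topology of the image at \<open>\<beta>\<close>. Density holds because points
  of \<open>Y\<close> realise every single coordinate of a thread.\<close>

lemma sigma_continuous_dense_index:
  "sigma_continuous_dense index inclusion (image_space Y) bonding"
  unfolding sigma_continuous_dense_def Let_def
proof (intro allI impI)
  fix s :: "nat \<Rightarrow> ('b \<Rightarrow> real) set" and \<beta>
  assume *: "(\<forall>n. s n \<in> index) \<and> (\<forall>n. (s n, s (Suc n)) \<in> inclusion) \<and>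
    is_supremum index inclusion (range s) \<beta>"
  define L where "L = inverse_limit UNIV {(m, n). m \<le> n} (\<lambda>n. image_space Y (s n))
    (\<lambda>m n. bonding (s m) (s n))"
  define \<epsilon> where "\<epsilon> = (\<lambda>x n. bonding (s n) \<beta> x)"
  have s: "s n \<in> index" for n using * by blast
  have "incseq s" unfolding incseq_Suc_iff using * inclusionD(3) by blast
  then have ss: "(s m, s n) \<in> inclusion" if "m \<le> n" for m n
    using that s by (simp add: inclusion_def incseq_def)
  have \<beta>: "\<beta> \<in> index" and s\<beta>: "(s n, \<beta>) \<in> inclusion" for n
    using * by (simp_all add: is_supremum_def)
  have "\<forall>\<Phi>\<in>range s. \<forall>\<Psi>\<in>range s. \<Phi> \<subseteq> \<Psi> \<or> \<Psi> \<subseteq> \<Phi>"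
    using inclusionD(3)[OF ss] nat_le_linear by blast
  \<comment> \<open>\<open>\<beta>\<close> is given only as some supremum; comparison with the union
    shows that each of its functions occurs in some \<open>s n\<close>.\<close>
  then have "is_supremum index inclusion (range s) (\<Union>(range s))"
    using s by (intro is_supremum_Union) auto
  then have "(\<beta>, \<Union>(range s)) \<in> inclusion"
    using * by (auto simp: is_supremum_def)
  then have \<beta>_sub: "\<beta> \<subseteq> \<Union>(range s)" by (rule inclusionD(3))
  have coord: "\<epsilon> (diag \<beta> y) n = diag (s n) y" for y n
    by (simp add: \<epsilon>_def bonding_inclusion[OF s\<beta>])
  have compat: "bonding (s m) (s n) (diag (s n) y) = diag (s m) y" if "m \<le> n" for m n y
    by (rule bonding_inclusion[OF ss[OF that]])
  have L_coord: "continuous_map L (image_space Y (s n)) (\<lambda>z. z n)" for n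
    unfolding L_def inverse_limit_def
    by (intro continuous_map_from_subtopology continuous_map_product_projection) simp
  have cont: "continuous_map (image_space Y \<beta>) L \<epsilon>"
  proof -
    have "continuous_map (image_space Y \<beta>)
       (product_topology (\<lambda>n. image_space Y (s n)) UNIV) \<epsilon>"
      unfolding continuous_map_componentwise_UNIV \<epsilon>_def
      by (intro allI continuous_map_bonding_inclusion s\<beta>)
    then show ?thesis
      unfolding L_def inverse_limit_def by (auto simp: continuous_map_in_subtopology coord compat)
  qed
  have "embedding_map (image_space Y \<beta>) L \<epsilon>"
  proof (rule embedding_map_weak_topologyI[OF cont])
    show "inj_on \<epsilon> (topspace (image_space Y \<beta>))"
    proof (rule inj_onI)
      fix x x' assume x: "x \<in> topspace (image_space Y \<beta>)" "x' \<in> topspace (image_space Y \<beta>)"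
        and eq: "\<epsilon> x = \<epsilon> x'"
      obtain y y' where y: "x = diag \<beta> y" "x' = diag \<beta> y'" using x by auto
      have "h y = h y'" if h: "h \<in> \<beta>" for h
      proof -
        obtain n where n: "h \<in> s n" using \<beta>_sub h by blast
        have "diag (s n) y = diag (s n) y'" using eq coord unfolding y by metis
        then show ?thesis using diag_to_nat_on[OF indexD(1)[OF s] n] by metis
      qed
      then show "x = x'" unfolding y by (rule diag_eqI[OF indexD(4)[OF \<beta>]])
    qed
  next
    fix U x assume U: "openin (image_space Y \<beta>) U" "x \<in> U"
    then have "x \<in> diag \<beta> ` topspace Y" using openin_subset by fastforce
    then obtain y where y: "y \<in> topspace Y" "x = diag \<beta> y" by blast
    obtain h where h: "h \<in> \<beta>" "0 < h y" "\<forall>y'\<in>topspace Y. 0 < h y' \<longrightarrow> diag \<beta> y' \<in> U"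
      using image_space_base[OF \<beta> U(1) y(1)] U(2) y(2) by blast
    obtain n where n: "h \<in> s n" using \<beta>_sub h(1) by blast
    define V where "V = positive_set L (\<lambda>z. z n (to_nat_on (s n) h))"
    have "continuous_map L euclideanreal ((\<lambda>z. z (to_nat_on (s n) h)) \<circ> (\<lambda>z. z n))"
      by (rule continuous_map_compose[OF L_coord continuous_map_image_space_coordinate])
    then have "openin L V"
      unfolding V_def by (intro openin_positive_set) (simp add: o_def)
    moreover have V: "\<epsilon> (diag \<beta> y') \<in> V \<longleftrightarrow> 0 < h y'" if y': "y' \<in> topspace Y" for y'
    proof -
      have "\<epsilon> (diag \<beta> y') \<in> topspace L"
        using continuous_map_funspace[OF cont] y' by auto
      then show ?thesis
        using diag_to_nat_on[OF indexD(1)[OF s] n] by (simp add: V_def positive_set_def coord)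
    qed
    moreover have "{x' \<in> topspace (image_space Y \<beta>). \<epsilon> x' \<in> V} \<subseteq> U"
      using V h(3) by auto
    ultimately show "\<exists>V. openin L V \<and> \<epsilon> x \<in> V \<and> {x' \<in> topspace (image_space Y \<beta>). \<epsilon> x' \<in> V} \<subseteq> U"
      using y h(2) by (intro exI[of _ V]) simp
  qed
  moreover have "topspace L \<subseteq> L closure_of (\<epsilon> ` topspace (image_space Y \<beta>))"
  proof
    fix z assume z: "z \<in> topspace L"
    have "\<exists>x\<in>\<epsilon> ` topspace (image_space Y \<beta>). x \<in> W" if W: "z \<in> W \<and> openin L W" for W
    proof -
      \<comment> \<open>Membership in \<open>W\<close> is guaranteed by one coordinate lying in
        \<open>V\<close>. That coordinate of \<open>z\<close> comes from some \<open>y\<close> in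
        \<open>Y\<close>, and the thread of \<open>y\<close> agrees with \<open>z\<close>
        there.\<close>
      have "\<exists>n V. openin (image_space Y (s n)) V \<and> z n \<in> V \<and> {z \<in> topspace L. z n \<in> V} \<subseteq> W"
      proof (rule inverse_sequence_limit_base[where T = "\<lambda>n. image_space Y (s n)"
            and q = "\<lambda>m n. bonding (s m) (s n)" and W = W and w = z, folded L_def])
        show "continuous_map (image_space Y (s n)) (image_space Y (s m)) (bonding (s m) (s n))"
          if "m \<le> n" for m n
          by (rule continuous_map_bonding_inclusion[OF ss[OF that]])
        show "openin L W" "z \<in> W" using W by simp_all
        fix n V assume "openin (image_space Y (s n)) V" "z n \<in> V" "{z \<in> topspace L. z n \<in> V} \<subseteq> W"
        then show "\<exists>n V. openin (image_space Y (s n)) V \<and> z n \<in> V \<and> {z \<in> topspace L. z n \<in> V} \<subseteq> W"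
          by (intro exI conjI)
      qed
      then obtain n V where V: "openin (image_space Y (s n)) V" "z n \<in> V"
        "{z \<in> topspace L. z n \<in> V} \<subseteq> W"
        by (elim exE conjE)
      have "z n \<in> topspace (image_space Y (s n))"
        using continuous_map_funspace[OF L_coord] z by auto
      then obtain y where y: "y \<in> topspace Y" "z n = diag (s n) y" by auto
      have "\<epsilon> (diag \<beta> y) \<in> topspace L"
        using continuous_map_funspace[OF cont] y(1) by auto
      moreover have "\<epsilon> (diag \<beta> y) n \<in> V" using V(2) y(2) by (simp add: coord)
      ultimately have "\<epsilon> (diag \<beta> y) \<in> W" using V(3) by blast
      then show ?thesis using y(1) by auto
    qed
    then show "z \<in> L closure_of (\<epsilon> ` topspace (image_space Y \<beta>))"
      using z by (simp add: in_closure_of)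
  qed
  ultimately show "embedding_map (image_space Y \<beta>)
      (inverse_limit UNIV {(m, n). m \<le> n} (\<lambda>n. image_space Y (s n)) (\<lambda>m n. bonding (s m) (s n)))
      (\<lambda>x n. bonding (s n) \<beta> x) \<and>
    inverse_limit UNIV {(m, n). m \<le> n} (\<lambda>n. image_space Y (s n)) (\<lambda>m n. bonding (s m) (s n))
      closure_of ((\<lambda>x n. bonding (s n) \<beta> x) ` topspace (image_space Y \<beta>)) =
    topspace (inverse_limit UNIV {(m, n). m \<le> n} (\<lambda>n. image_space Y (s n))
      (\<lambda>m n. bonding (s m) (s n)))"
    unfolding L_def[symmetric] \<epsilon>_def[symmetric] using closure_of_subset_topspace[of L] by blast
qed

lemma ex_index_mem:
  assumes "continuous_map Y euclideanreal h"
  obtains \<Psi> where "\<Psi> \<in> index" "h \<in> \<Psi>"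
proof -
  obtain \<Psi> where "\<Psi> \<in> index" "{h} \<subseteq> \<Psi>"
    by (rule ex_index[of "{h}"]) (use assms in simp_all)
  then show thesis by (intro that) simp_all
qed

text \<open>Every bump function on \<open>Y\<close> is a coordinate of some member of the system, so
  the open sets of \<open>Y\<close> are recovered. Restriction to \<open>index\<close> makes the
  values extensional, as points of the product are.\<close>

lemma embedding_map_index:
  "embedding_map Y (inverse_limit index inclusion (image_space Y) bonding)
     (\<lambda>y. \<lambda>\<Psi>\<in>index. diag \<Psi> y)"
    (is "embedding_map Y ?L ?e")
proof (rule embedding_map_weak_topologyI)
  have reg: "completely_regular_space Y" and haus: "Hausdorff_space Y"
    using tychonoff by (simp_all add: tychonoff_space_def)
  have "continuous_map Y (product_topology (image_space Y) index) ?e"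
    unfolding continuous_map_componentwise
    using continuous_map_diag[OF indexD(4,2)] by auto
  moreover have "bonding \<Phi> \<Psi> (?e y \<Psi>) = ?e y \<Phi>" if "(\<Phi>, \<Psi>) \<in> inclusion" for \<Phi> \<Psi> y
    using that inclusionD[OF that] by (simp add: bonding_inclusion)
  ultimately show cont: "continuous_map Y ?L ?e"
    unfolding inverse_limit_def by (simp add: continuous_map_in_subtopology image_subset_iff)
  have separate: "\<exists>V. openin ?L V \<and> ?e y \<in> V \<and> {y' \<in> topspace Y. ?e y' \<in> V} \<subseteq> U"
    if U: "openin Y U" "y \<in> U" for U y
  proof -
    obtain h where h: "continuous_map Y euclideanreal h" "0 < h y" "{y \<in> topspace Y. 0 < h y} \<subseteq> U"
      by (rule completely_regular_space_bump[OF reg U])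
    obtain \<Psi> where \<Psi>: "\<Psi> \<in> index" "h \<in> \<Psi>" by (rule ex_index_mem[OF h(1)])
    define V where "V = positive_set ?L (\<lambda>z. z \<Psi> (to_nat_on \<Psi> h))"
    have "continuous_map ?L (image_space Y \<Psi>) (\<lambda>z. z \<Psi>)"
      unfolding inverse_limit_def
      by (intro continuous_map_from_subtopology continuous_map_product_projection \<Psi>(1))
    from continuous_map_compose[OF this continuous_map_image_space_coordinate]
    have "openin ?L V"
      unfolding V_def by (intro openin_positive_set) (simp add: o_def)
    moreover have V: "?e y' \<in> V \<longleftrightarrow> 0 < h y'" if y': "y' \<in> topspace Y" for y'
    proof -
      have "?e y' \<in> topspace ?L"
        using funcset_mem[OF continuous_map_funspace[OF cont] y'] .
      then show ?thesis
        using diag_to_nat_on[OF indexD(1)[OF \<Psi>(1)] \<Psi>(2)] \<Psi>(1)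
        by (simp add: V_def positive_set_def)
    qed
    moreover have "y \<in> topspace Y" using U openin_subset by blast
    ultimately show ?thesis
      using h(2,3) by (intro exI[of _ V]) auto
  qed
  show "\<exists>V. openin ?L V \<and> ?e y \<in> V \<and> {y' \<in> topspace Y. ?e y' \<in> V} \<subseteq> U"
    if "openin Y U" "y \<in> U" for U y
    using that by (rule separate)
  \<comment> \<open>By \<open>separate\<close>, a point with the same image as \<open>y\<close> lies
    in every neighbourhood of \<open>y\<close>.\<close>
  show "inj_on ?e (topspace Y)"
  proof (rule inj_onI, rule ccontr)
    fix y y' assume y: "y \<in> topspace Y" "y' \<in> topspace Y" "?e y = ?e y'" "y \<noteq> y'"
    obtain U V where UV: "openin Y U" "openin Y V" "y \<in> U" "y' \<in> V" "disjnt U V"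
      using haus y(1,2,4) unfolding Hausdorff_space_def by metis
    obtain W where W: "?e y \<in> W" "{y' \<in> topspace Y. ?e y' \<in> W} \<subseteq> U"
      using separate[OF UV(1,3)] by (elim exE conjE)
    have "y' \<in> U" using W y(2,3) by auto
    then show False using UV(4,5) by (auto simp: disjnt_iff)
  qed
qed

lemma skeletal_generation_index:
  "skeletal_generation Y index inclusion (image_space Y) bonding (\<lambda>y. \<lambda>\<Psi>\<in>index. diag \<Psi> y)"
  unfolding skeletal_generation_def
proof (intro conjI ballI allI impI)
  fix \<Psi> assume \<Psi>: "\<Psi> \<in> index"
  show "metrizable_space (image_space Y \<Psi>)"
    unfolding image_space_def by (intro metrizable_space_subtopology metrizable_space_euclidean)
  \<comment> \<open>Separability need not pass to subspaces, so it is derived from second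
    countability of the whole power.\<close>
  have "second_countable (euclidean :: (nat \<Rightarrow> real) topology)"
  proof -
    obtain B :: "(nat \<Rightarrow> real) set set" where "countable B" "topological_basis B"
      using ex_countable_basis by blast
    then show ?thesis
      unfolding second_countable_def
      by (intro exI[of _ B]) (auto simp: topological_basis_open elim: topological_basisE)
  qed
  then show "separable_space (image_space Y \<Psi>)"
    unfolding image_space_def
    by (intro second_countable_imp_separable_space second_countable_subtopology)
  show "(\<lambda>y. (\<lambda>\<Psi>\<in>index. diag \<Psi> y) \<Psi>) ` topspace Y = topspace (image_space Y \<Psi>)"
    using \<Psi> by simp
next
  fix \<Phi> \<Psi> assume *: "(\<Phi>, \<Psi>) \<in> inclusion"
  show "bonding \<Phi> \<Psi> ` topspace (image_space Y \<Psi>) = topspace (image_space Y \<Phi>)"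
    by (simp add: image_image bonding_inclusion[OF *])
  show "skeletal_map (image_space Y \<Psi>) (image_space Y \<Phi>) (bonding \<Phi> \<Psi>)"
    by (rule skeletal_map_bonding[OF *])
next
  fix f :: "'b \<Rightarrow> real" assume f: "continuous_map Y euclideanreal f \<and> bounded (f ` topspace Y)"
  obtain \<Psi> where \<Psi>: "\<Psi> \<in> index" "f \<in> \<Psi>" by (rule ex_index_mem[OF conjunct1[OF f]])
  have coord: "diag \<Psi> y (to_nat_on \<Psi> f) = f y" for y
    by (rule diag_to_nat_on[OF indexD(1)[OF \<Psi>(1)] \<Psi>(2)])
  \<comment> \<open>\<open>f\<close> is itself a coordinate of \<open>diag \<Psi>\<close>, hence
    factors through the evaluation at its number.\<close>
  have "map_prec Y (image_space Y \<Psi>) euclideanreal (\<lambda>y. (\<lambda>\<Psi>\<in>index. diag \<Psi> y) \<Psi>) f"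
    unfolding map_prec_def
    using continuous_map_image_space_coordinate[of Y \<Psi> "to_nat_on \<Psi> f"] \<Psi>(1)
    by (intro exI[of _ "\<lambda>z. z (to_nat_on \<Psi> f)"])
      (auto simp: continuous_map_in_subtopology coord intro: continuous_map_from_subtopology)
  then show "\<exists>\<alpha>\<in>index. map_prec Y (image_space Y \<alpha>) euclideanreal (\<lambda>y. (\<lambda>\<Psi>\<in>index. diag \<Psi> y) \<alpha>) f"
    using \<Psi>(1) by blast
qed (fact inverse_system_index sigma_complete_index sigma_continuous_dense_index
    embedding_map_index)+

end

section \<open>Assembling the system that generates \<open>Y\<close>\<close>

theorem theorem2p4:
  fixes X :: "'a topology" and Y :: "'b topology"
  assumes "tychonoff_space X" and "tychonoff_space Y"
    and "skeletally_generated TYPE('i) TYPE('c) X"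
    and "co_absolute TYPE('e) TYPE('f) X Y"
  shows "skeletally_generated TYPE(('b \<Rightarrow> real) set) TYPE(nat \<Rightarrow> real) Y"
proof -
  obtain A :: "'i set" and r and S :: "'i \<Rightarrow> 'c topology" and p e
    where "skeletal_generation X A r S p e"
    using assms(3) unfolding skeletally_generated_def by (elim exE)
  then interpret X: skeletal_system X A r S p e by (rule skeletal_system.intro)
  obtain E :: "'e topology" and F :: "'f topology" where
    "absolute_of E X" "absolute_of F Y" "E homeomorphic_space F"
    using assms(4) unfolding co_absolute_def by (elim exE conjE)
  then obtain f g k where "perfect_irreducible_map E X f" "perfect_irreducible_map F Y g"
    "homeomorphic_map E F k"
    unfolding absolute_of_def homeomorphic_space by (elim exE conjE)
  then have f: "tight_map E X f" and g: "tight_map E Y (g \<circ> k)"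
    by (blast intro: perfect_irreducible_imp_tight_map homeomorphic_imp_tight_map
        tight_map_compose)+
  have reg: "completely_regular_space X" "completely_regular_space Y"
    using assms(1,2) by (simp_all add: tychonoff_space_def)
  obtain c where c:
    "\<forall>F. finite F \<and> F \<subseteq> real_maps Y \<longrightarrow> countable (c F) \<and> c F \<subseteq> real_maps Y"
    "\<forall>\<Psi>. countable \<Psi> \<and> \<Psi> \<noteq> {} \<and> \<Psi> \<subseteq> real_maps Y \<and> closed_under c \<Psi> \<and>
      (\<forall>h\<in>\<Psi>. \<forall>h'\<in>\<Psi>. (\<lambda>y. min (h y) (h' y)) \<in> \<Psi>) \<longrightarrow> skeletal_family Y \<Psi>"
    using X.ex_skeletal_closure_operation[OF reg f g] by (elim exE conjE)
  \<comment> \<open>Families closed under \<open>d\<close> are closed under both operations: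
    \<open>lattice_ops\<close> supplies the base of the image as well as the non-emptiness and
    closure under \<open>min\<close> that the property of \<open>c\<close> requires.\<close>
  define d where "d F = c F \<union> lattice_ops F" for F
  interpret Y: skeletal_families Y d
  proof
    show "tychonoff_space Y" by fact
    show "countable (d F) \<and> d F \<subseteq> real_maps Y" if "finite F" "F \<subseteq> real_maps Y" for F
      using c(1)[THEN spec[of _ F]] that countable_lattice_ops[OF countable_finite[OF that(1)]]
        lattice_ops_real_maps[OF that(2)] by (simp add: d_def)
    show ops: "\<forall>F. finite F \<longrightarrow> lattice_ops F \<subseteq> d F" by (simp add: d_def)
    show "skeletal_family Y \<Psi>"
      if \<Psi>: "countable \<Psi>" "\<Psi> \<subseteq> real_maps Y" "closed_under d \<Psi>" for \<Psi>
    proof -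
      note closed = closed_under_lattice_ops[OF \<Psi>(3) ops]
      have "\<Psi> \<noteq> {}" using closed(1) by blast
      moreover have "closed_under c \<Psi>"
        using \<Psi>(3) by (simp add: closed_under_def d_def)
      ultimately show ?thesis
        using c(2)[THEN spec[of _ \<Psi>]] \<Psi>(1,2) closed(2) by simp
    qed
  qed
  show ?thesis
    unfolding skeletally_generated_def using Y.skeletal_generation_index by blast
qed

end
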